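(* Let $(C_{\rm mp}(t))_{t\in\mathbb R}$ be the moments-preserving cosine family on $C[0,1]$, $C_{\rm mp}(t)f(x)=\frac12(\tilde f(x+t)+\tilde f(x-t))$, $x\in[0,1]$, where $\tilde f$ is the integral extension of $f$. (a) The cosine family $(C_{\rm mp}(t))_{t\in\mathbb R}$ leaves the subspace $C_{\rm even}[0,1]$ invariant, and is a cosine family of contractions there. The generator $A_0$ of $(C_{\rm mp}(t))_{t\in\mathbb R}$ restricted to $C_{\rm even}[0,1]$ is given by $A_0f=f''$ with domain composed of all twice continuously differentiable $f\in C_{\rm even}[0,1]$ satisfying $f'(0)=0$. (b) The cosine family $(C_{\rm mp}(t))_{t\in\mathbb R}$ leaves the subspace $C_{\rm odd}[0,1]$ invariant. The generator $A_1$ of $(C_{\rm mp}(t))_{t\in\mathbb R}$ restricted to $C_{\rm odd}[0,1]$ is given by $A_1f=f''$ with domain composed of all twice continuously differentiable $f\in C_{\rm odd}[0,1]$ satisfying $f'(0)=-2f(0)$. (c) Denoting by $(C_{A_0}(t))_{t\in\mathbb R}$ and $(C_{A_1}(t))_{t\in\mathbb R}$ the cosine family $(C_{\rm mp}(t))_{t\in\mathbb R}$ as restricted to the subspaces $C_{\rm even}[0,1]$ and $C_{\rm odd}[0,1]$, respectively, we have $$C_{\rm mp}(t)f=C_{A_0}(t)f_{\rm even}+C_{A_1}(t)f_{\rm odd},\qquad f\in C[0,1],\ t\in\mathbb R.$$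
   Context: $C[0,1]$ is the Banach space of continuous real-valued functions on $[0,1]$ with the supremum norm; $\mathbb N=\{0,1,2,\dots\}$. $C_{\rm even}[0,1]$ and $C_{\rm odd}[0,1]$ are the closed subspaces of those $f\in C[0,1]$ with $f(1-x)=f(x)$, respectively $f(1-x)=-f(x)$, for all $x\in[0,1]$. For $f\in C[0,1]$, $f_{\rm even}(x)=\frac12[f(x)+f(1-x)]$ and $f_{\rm odd}(x)=\frac12[f(x)-f(1-x)]$. Integral extension: given $f\in C[0,1]$, define $g_n,h_n\in C[0,1]$, $n\in\mathbb N$, recursively by $g_0(x)=f(x)$, $h_0(x)=f(1-x)$, and $h_{n+1}=g_n-\psi_n$, $g_{n+1}=h_n+\psi_n$, where $d_n=h_n-g_n$ and $\psi_n(x)=-e^{2x}\int_0^1d_n(y)\,dy+2\int_0^xe^{2(x-y)}d_n(y)\,dy$. Then $\tilde f:\mathbb R\to\mathbb R$ is the (well-defined, continuous) function determined by $\tilde f(x+n)=g_n(x)$ and $\tilde f(1-x-n)=h_n(x)$ for $x\in[0,1]$, $n\in\mathbb N$. The family $(C_{\rm mp}(t))_{t\in\mathbb R}$ is a strongly continuous cosine family on $C[0,1]$ whose generator is $Af=f''$ with $D(A)=\{f\in C^2[0,1]:f'(0)=f'(1)=f(1)-f(0)\}$. A strongly continuous cosine family on a Banach space $X$ is a family $(\mathrm{Cos}(t))_{t\in\mathbb R}$ of bounded linear operators with $\mathrm{Cos}(0)=\mathrm{Id}$, $2\,\mathrm{Cos}(t)\mathrm{Cos}(s)=\mathrm{Cos}(t+s)+\mathrm{Cos}(t-s)$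 for all $s,t$, and $\lim_{t\to0}\mathrm{Cos}(t)x=x$ for all $x\in X$; its generator is $x\mapsto\lim_{t\to0}\frac2{t^2}(\mathrm{Cos}(t)x-x)$ with domain the set of $x$ for which this limit exists. *)

theory Defs
  imports "HOL-Analysis.Analysis"
begin

section \<open>The Banach space $C[0,1]$\<close>

typedef unit_interval = "{0..1::real}"
  morphisms real_of_unit Unit
  by auto

instantiation unit_interval :: metric_space
begin

definition dist_unit_interval :: "unit_interval \<Rightarrow> unit_interval \<Rightarrow> real"
  where "dist_unit_interval u v = dist (real_of_unit u) (real_of_unit v)"

definition uniformity_unit_interval :: "(unit_interval \<times> unit_interval) filter"
  where "uniformity_unit_interval = (INF e\<in>{0 <..}. principal {(u, v). dist u v < e})"

definition open_unit_interval :: "unit_interval set \<Rightarrow> bool"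
  where "open_unit_interval S = (\<forall>u\<in>S. \<forall>\<^sub>F (u', v) in uniformity. u' = u \<longrightarrow> v \<in> S)"

instance
proof
  fix u v w :: unit_interval
  show "dist u v = 0 \<longleftrightarrow> u = v"
    by (simp add: dist_unit_interval_def real_of_unit_inject)
  show "dist u v \<le> dist u w + dist v w"
    unfolding dist_unit_interval_def by (rule dist_triangle2)
qed (rule open_unit_interval_def uniformity_unit_interval_def)+

end

instance bcontfun :: (metric_space, banach) banach ..

text \<open>
  As \<open>unit_interval\<close> is compact, every continuous function on it is bounded, so the
  library's Banach space of bounded continuous functions, with its supremum norm, is $C[0,1]$.
  The functions \<open>val\<close> and \<open>C01_of\<close> translate between elements of $C[0,1]$ and functions
  of a real variable, of which only the values on $[0,1]$ matter
  (lemmas \<open>continuous_on_val\<close>, \<open>val_C01_of\<close> and \<open>norm_C01\<close> below).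
\<close>

type_synonym C01 = "unit_interval \<Rightarrow>\<^sub>C real"

definition val :: "C01 \<Rightarrow> real \<Rightarrow> real"
  where "val f x = apply_bcontfun f (Unit x)"

definition C01_of :: "(real \<Rightarrow> real) \<Rightarrow> C01"
  where "C01_of \<phi> = Bcontfun (\<lambda>u. \<phi> (real_of_unit u))"

definition C_even :: "C01 set"
  where "C_even = {f. \<forall>x\<in>{0..1}. val f (1 - x) = val f x}"

definition C_odd :: "C01 set"
  where "C_odd = {f. \<forall>x\<in>{0..1}. val f (1 - x) = - val f x}"

definition even_part :: "C01 \<Rightarrow> C01"
  where "even_part f = C01_of (\<lambda>x. (1/2) * (val f x + val f (1 - x)))"

definition odd_part :: "C01 \<Rightarrow> C01"
  where "odd_part f = C01_of (\<lambda>x. (1/2) * (val f x - val f (1 - x)))"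

text \<open>Derivatives on $[0,1]$ are one-sided at the end points.\<close>

definition deriv01 :: "(real \<Rightarrow> real) \<Rightarrow> real \<Rightarrow> real"
  where "deriv01 \<phi> x = vector_derivative \<phi> (at x within {0..1})"

definition C2_01 :: "C01 set"
  where "C2_01 = {f. val f differentiable_on {0..1}
                   \<and> deriv01 (val f) differentiable_on {0..1}
                   \<and> continuous_on {0..1} (deriv01 (deriv01 (val f)))}"

definition second_deriv :: "C01 \<Rightarrow> C01"
  where "second_deriv f = C01_of (deriv01 (deriv01 (val f)))"


section \<open>Cosine families and their generators\<close>

text \<open>
  The Banach space on which a cosine family acts is given as a closed subspace \<open>X\<close> of a type
  of class \<open>banach\<close>, so that restrictions to closed subspaces can be treated;
  operators are relevant on \<open>X\<close> only.
\<close>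

definition bounded_operator_on :: "'a::banach set \<Rightarrow> ('a \<Rightarrow> 'a) \<Rightarrow> bool"
  where "bounded_operator_on X T \<longleftrightarrow>
     T ` X \<subseteq> X
   \<and> (\<forall>x\<in>X. \<forall>y\<in>X. T (x + y) = T x + T y)
   \<and> (\<forall>c. \<forall>x\<in>X. T (c *\<^sub>R x) = c *\<^sub>R T x)
   \<and> (\<exists>K. \<forall>x\<in>X. norm (T x) \<le> K * norm x)"

definition cosine_family_on :: "'a::banach set \<Rightarrow> (real \<Rightarrow> 'a \<Rightarrow> 'a) \<Rightarrow> bool"
  where "cosine_family_on X Cos \<longleftrightarrow>
     subspace X \<and> closed X
   \<and> (\<forall>t. bounded_operator_on X (Cos t))
   \<and> (\<forall>x\<in>X. Cos 0 x = x)
   \<and> (\<forall>s t. \<forall>x\<in>X. 2 *\<^sub>R Cos t (Cos s x) = Cos (t + s) x + Cos (t - s) x)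
   \<and> (\<forall>x\<in>X. ((\<lambda>t. Cos t x) \<longlongrightarrow> x) (at 0))"

definition contractions_on :: "'a::banach set \<Rightarrow> (real \<Rightarrow> 'a \<Rightarrow> 'a) \<Rightarrow> bool"
  where "contractions_on X Cos \<longleftrightarrow> (\<forall>t. \<forall>x\<in>X. norm (Cos t x) \<le> norm x)"

definition generator_domain :: "'a::banach set \<Rightarrow> (real \<Rightarrow> 'a \<Rightarrow> 'a) \<Rightarrow> 'a set"
  where "generator_domain X Cos =
     {x\<in>X. \<exists>y\<in>X. ((\<lambda>t. (2 / t\<^sup>2) *\<^sub>R (Cos t x - x)) \<longlongrightarrow> y) (at 0)}"

definition generator :: "(real \<Rightarrow> 'a \<Rightarrow> 'a::banach) \<Rightarrow> 'a \<Rightarrow> 'a"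
  where "generator Cos x = Lim (at 0) (\<lambda>t. (2 / t\<^sup>2) *\<^sub>R (Cos t x - x))"


section \<open>The integral extension and the moments-preserving cosine family\<close>

definition psi :: "(real \<Rightarrow> real) \<Rightarrow> real \<Rightarrow> real"
  where "psi d x = - exp (2 * x) * integral {0..1} d
                   + 2 * integral {0..x} (\<lambda>y. exp (2 * (x - y)) * d y)"

fun ext_g :: "(real \<Rightarrow> real) \<Rightarrow> nat \<Rightarrow> real \<Rightarrow> real"
  and ext_h :: "(real \<Rightarrow> real) \<Rightarrow> nat \<Rightarrow> real \<Rightarrow> real"
  where
    "ext_g \<phi> 0 x = \<phi> x"
  | "ext_h \<phi> 0 x = \<phi> (1 - x)"
  | "ext_g \<phi> (Suc n) x = ext_h \<phi> n x + psi (\<lambda>y. ext_h \<phi> n y - ext_g \<phi> n y) x"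
  | "ext_h \<phi> (Suc n) x = ext_g \<phi> n x - psi (\<lambda>y. ext_h \<phi> n y - ext_g \<phi> n y) x"

text \<open>
  Every $y \ge 0$ is uniquely $x + n$, and every $y < 0$ is uniquely $1 - x - n$, with
  $x \in [0,1)$ and $n \in \nat$. That the resulting function is continuous and satisfies the
  defining relations for all $x \in [0,1]$ is shown in \<open>int_ext_eqs\<close> and
  \<open>continuous_int_ext\<close>.
\<close>

definition int_ext :: "C01 \<Rightarrow> real \<Rightarrow> real"
  where "int_ext f y =
    (if 0 \<le> y then ext_g (val f) (nat \<lfloor>y\<rfloor>) (frac y)
     else ext_h (val f) (nat \<lfloor>1 - y\<rfloor>) (frac (1 - y)))"

definition C_mp :: "real \<Rightarrow> C01 \<Rightarrow> C01"
  where "C_mp t f = C01_of (\<lambda>x. (1/2) * (int_ext f (x + t) + int_ext f (x - t)))"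

definition C_A0 :: "real \<Rightarrow> C01 \<Rightarrow> C01"
  where "C_A0 t = restrict (C_mp t) C_even"

definition C_A1 :: "real \<Rightarrow> C01 \<Rightarrow> C01"
  where "C_A1 t = restrict (C_mp t) C_odd"


section \<open>Well-definedness\<close>

lemma real_of_unit_range: "real_of_unit u \<in> {0..1}"
  by (rule real_of_unit)

lemma continuous_real_of_unit: "continuous_on UNIV real_of_unit"
  unfolding continuous_on_iff dist_unit_interval_def by blast

lemma continuous_Unit: "continuous_on {0..1} Unit"
  unfolding continuous_on_iff dist_unit_interval_def
  by (auto simp: Unit_inverse)

lemma continuous_on_val: "continuous_on {0..1} (val f)"
proof -
  have "continuous_on {0..1} (\<lambda>x. apply_bcontfun f (Unit x))"
    by (rule continuous_on_compose2[OF continuous_on_apply_bcontfun[of UNIV f] continuous_Unit]) auto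
  then show ?thesis
    by (simp add: val_def[abs_def])
qed

lemma C01_of_bcontfun:
  assumes "continuous_on {0..1} \<phi>"
  shows "(\<lambda>u. \<phi> (real_of_unit u)) \<in> bcontfun"
proof -
  have "continuous_on UNIV (\<lambda>u. \<phi> (real_of_unit u))"
    by (rule continuous_on_compose2[OF assms continuous_real_of_unit])
      (use real_of_unit_range in auto)
  moreover have "bounded (\<phi> ` {0..1})"
    by (intro compact_imp_bounded compact_continuous_image assms) auto
  then have "bounded (range (\<lambda>u. \<phi> (real_of_unit u)))"
    by (rule bounded_subset) (use real_of_unit_range in auto)
  ultimately show ?thesis
    by (simp add: bcontfun_def)
qed

lemma val_C01_of:
  assumes "continuous_on {0..1} \<phi>" "x \<in> {0..1}"
  shows "val (C01_of \<phi>) x = \<phi> x"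
  using assms by (simp add: val_def C01_of_def Bcontfun_inverse C01_of_bcontfun Unit_inverse)

lemma C01_of_val: "C01_of (val f) = f"
  by (simp add: val_def C01_of_def real_of_unit_inverse apply_bcontfun_inverse)

lemma norm_C01: "norm f = (SUP x\<in>{0..1}. \<bar>val f x\<bar>)"
proof -
  have "range (\<lambda>u. \<bar>apply_bcontfun f u\<bar>) = (\<lambda>x. \<bar>val f x\<bar>) ` {0..1}"
  proof
    show "range (\<lambda>u. \<bar>apply_bcontfun f u\<bar>) \<subseteq> (\<lambda>x. \<bar>val f x\<bar>) ` {0..1}"
    proof clarify
      fix u
      show "\<bar>apply_bcontfun f u\<bar> \<in> (\<lambda>x. \<bar>val f x\<bar>) ` {0..1}"
        by (rule image_eqI[of _ _ "real_of_unit u"])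
          (simp_all add: val_def real_of_unit_inverse real_of_unit_range del: atLeastAtMost_iff)
    qed
  qed (auto simp: val_def)
  then show ?thesis
    by (simp add: norm_bcontfun_def dist_bcontfun.rep_eq)
qed

lemma psi_alt:
  assumes d: "continuous_on {0..1} d" and x: "x \<in> {0..1}"
  shows "psi d x = exp (2 * x) * (2 * integral {0..x} (\<lambda>y. exp (- 2 * y) * d y) - integral {0..1} d)"
proof -
  have "integral {0..x} (\<lambda>y. exp (2 * (x - y)) * d y)
      = integral {0..x} (\<lambda>y. exp (2 * x) * (exp (- 2 * y) * d y))"
    by (intro integral_cong) (simp add: algebra_simps flip: exp_add)
  also have "\<dots> = exp (2 * x) * integral {0..x} (\<lambda>y. exp (- 2 * y) * d y)"
    by (rule integral_mult_right)
  finally show ?thesis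
    by (simp only: psi_def) (simp add: algebra_simps)
qed

lemma psi_deriv:
  assumes d: "continuous_on {0..1} d" and x: "x \<in> {0..1}"
  shows "(psi d has_real_derivative 2 * psi d x + 2 * d x) (at x within {0..1})"
proof -
  have c: "continuous_on {0..1} (\<lambda>y. exp (- 2 * y) * d y)"
    by (intro continuous_intros d)
  have I: "((\<lambda>x. integral {0..x} (\<lambda>y. exp (- 2 * y) * d y)) has_real_derivative exp (- 2 * x) * d x)
      (at x within {0..1})"
    using integral_has_real_derivative[OF c x] .
  have "((\<lambda>x. exp (2 * x) * (2 * integral {0..x} (\<lambda>y. exp (- 2 * y) * d y) - integral {0..1} d))
      has_real_derivative 2 * psi d x + 2 * d x) (at x within {0..1})"
    by (rule derivative_eq_intros I refl)+
      (simp add: psi_alt[OF d x] algebra_simps flip: exp_add)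
  then show ?thesis
    by (rule has_field_derivative_transform_within[where d = 1]) (use x psi_alt[OF d] in auto)
qed

lemma continuous_psi:
  assumes "continuous_on {0..1} d"
  shows "continuous_on {0..1} (psi d)"
  by (rule DERIV_continuous_on[OF psi_deriv[OF assms]])

lemma psi_0: "psi d 0 = - integral {0..1} d"
  by (simp add: psi_def)

lemma psi_1:
  assumes "continuous_on {0..1} d"
  shows "psi d 1 - psi d 0 = 2 * integral {0..1} (psi d) + 2 * integral {0..1} d"
proof -
  have "((\<lambda>x. 2 * psi d x + 2 * d x) has_integral (psi d 1 - psi d 0)) {0..1}"
    by (rule fundamental_theorem_of_calculus)
      (use psi_deriv[OF assms] in \<open>auto simp: has_real_derivative_iff_has_vector_derivative\<close>)
  moreover have "integral {0..1} (\<lambda>x. 2 * psi d x + 2 * d x)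
      = 2 * integral {0..1} (psi d) + 2 * integral {0..1} d"
    by (subst integral_add)
      (auto intro!: integrable_continuous_interval continuous_intros continuous_psi assms)
  ultimately show ?thesis
    by (simp add: integral_unique)
qed

lemma continuous_ext_gh:
  assumes "continuous_on {0..1} \<phi>"
  shows "continuous_on {0..1} (ext_g \<phi> n) \<and> continuous_on {0..1} (ext_h \<phi> n)"
proof (induction n)
  case 0
  have "continuous_on {0..1} (\<lambda>x. \<phi> (1 - x))"
    by (rule continuous_on_compose2[OF assms]) (auto intro!: continuous_intros)
  then show ?case
    using assms by simp
next
  case (Suc n)
  then show ?case
    by (auto intro!: continuous_intros continuous_psi)
qed

lemma ext_glue:
  assumes \<phi>: "continuous_on {0..1} \<phi>"
  shows "ext_g \<phi> n 1 = ext_g \<phi> (Suc n) 0 \<and> ext_h \<phi> n 1 = ext_h \<phi> (Suc n) 0"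
proof -
  define d where "d n y = ext_h \<phi> n y - ext_g \<phi> n y" for n y
  have cd: "continuous_on {0..1} (d n)" for n
    using continuous_ext_gh[OF \<phi>] unfolding d_def[abs_def] by (intro continuous_intros) auto
  have g: "ext_g \<phi> (Suc n) x = ext_h \<phi> n x + psi (d n) x"
    and h: "ext_h \<phi> (Suc n) x = ext_g \<phi> n x - psi (d n) x" for n x
    by (simp_all add: d_def[abs_def])
  have "ext_g \<phi> n 1 - ext_h \<phi> n 0 = - integral {0..1} (d n)
      \<and> ext_h \<phi> n 1 - ext_g \<phi> n 0 = integral {0..1} (d n)"
  proof (induction n)
    case 0
    have c: "continuous_on {0..1} (\<lambda>x. \<phi> (1 - x))"
      by (rule continuous_on_compose2[OF \<phi>]) (auto intro!: continuous_intros)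
    have "integral {0..1} (\<lambda>x. \<phi> (1 - x)) = integral {0..1} \<phi>"
      using \<phi> has_integral_affinity[of \<phi> "integral {0..1} \<phi>" 0 1 "-1" 1]
      by (auto intro!: integral_unique dest!: integrable_continuous_interval integrable_integral)
    moreover have "d 0 = (\<lambda>x. \<phi> (1 - x) - \<phi> x)"
      by (simp add: d_def fun_eq_iff)
    ultimately have "integral {0..1} (d 0) = 0"
      using integral_diff[OF integrable_continuous_interval[OF c] integrable_continuous_interval[OF \<phi>]]
      by simp
    then show ?case by simp
  next
    case (Suc n)
    have "d (Suc n) = (\<lambda>x. - d n x - 2 * psi (d n) x)"
      by (simp add: fun_eq_iff d_def[of "Suc n"] g h del: ext_g.simps ext_h.simps)
        (simp add: d_def)
    then have "integral {0..1} (d (Suc n)) = - integral {0..1} (d n) - 2 * integral {0..1} (psi (d n))"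
      by simp (subst integral_diff,
        auto intro!: integrable_continuous_interval continuous_intros continuous_psi cd)
    then show ?case
      using Suc psi_1[OF cd[of n]] psi_0[of "d n"]
      by (simp add: g h del: ext_g.simps ext_h.simps)
  qed
  then show ?thesis
    using psi_0[of "d n"] by (simp add: g h del: ext_g.simps ext_h.simps)
qed

lemma int_ext_eqs:
  assumes x: "x \<in> {0..1}"
  shows "int_ext f (x + real n) = ext_g (val f) n x"
    and "int_ext f (1 - x - real n) = ext_h (val f) n x"
proof -
  note glue = ext_glue[OF continuous_on_val[of f]]
  have g: "int_ext f (x + real n) = ext_g (val f) n x" if "0 \<le> x" "x < 1" for x n
  proof -
    have "\<lfloor>x + real n\<rfloor> = int n"
      using that by (simp add: floor_eq_iff)
    then show ?thesis
      using that by (simp add: int_ext_def frac_def)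
  qed
  have h: "int_ext f (1 - x - real n) = ext_h (val f) n x" if "0 \<le> x" "x < 1" "1 - x - real n < 0" for x n
  proof -
    have "\<lfloor>x + real n\<rfloor> = int n"
      using that by (simp add: floor_eq_iff)
    moreover have "1 - (1 - x - real n) = x + real n" by simp
    ultimately show ?thesis
      using that by (simp only: int_ext_def frac_def) simp
  qed
  show g1: "int_ext f (x + real n) = ext_g (val f) n x" for n
  proof (cases "x < 1")
    case False
    with x have "x = 1" by simp
    then show ?thesis
      using g[of 0 "Suc n"] glue[of n] by (simp add: add.commute)
  qed (use x g in auto)
  have h0: "int_ext f (1 - x) = ext_h (val f) 0 x" if "0 \<le> x" "x \<le> 1" for x
  proof (cases "x = 0")
    case True
    then show ?thesis
      using g[of 0 1] glue[of 0] by simp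
  next
    case False
    then show ?thesis
      using g[of "1 - x" 0] that by simp
  qed
  show "int_ext f (1 - x - real n) = ext_h (val f) n x"
  proof (cases n)
    case 0
    then show ?thesis using h0[of x] x by simp
  next
    case n: (Suc m)
    consider "x = 1" | "x = 0" "m = 0" | "x < 1" "1 - x - real n < 0"
      using x n by fastforce
    then show ?thesis
    proof cases
      case 1
      then show ?thesis
        using h[of 0 "Suc n"] glue[of n] n by (simp add: algebra_simps)
    next
      case 2
      then show ?thesis
        using h0[of 1] glue[of 0] n by simp
    next
      case 3
      then show ?thesis using h x by auto
    qed
  qed
qed

lemma continuous_int_ext: "continuous_on UNIV (int_ext f)"
proof -
  have piece: "continuous_on {of_int k .. of_int k + 1} (int_ext f)" for k :: int
  proof (cases "0 \<le> k")
    case True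
    define n where "n = nat k"
    have k: "of_int k = real n" using True by (simp add: n_def)
    have "continuous_on {of_int k .. of_int k + 1} (\<lambda>y. ext_g (val f) n (y - real n))"
      by (rule continuous_on_compose2[OF continuous_ext_gh[OF continuous_on_val, THEN conjunct1]])
        (auto simp: k intro!: continuous_intros)
    moreover have "int_ext f y = ext_g (val f) n (y - real n)" if "y \<in> {of_int k .. of_int k + 1}" for y
      using int_ext_eqs(1)[of "y - real n" f n] that by (auto simp: k)
    ultimately show ?thesis
      by (metis (no_types, lifting) continuous_on_eq)
  next
    case False
    define n where "n = nat (- k)"
    have k: "of_int k = - real n" using False by (simp add: n_def)
    have "continuous_on {of_int k .. of_int k + 1} (\<lambda>y. ext_h (val f) n (1 - y - real n))"
      by (rule continuous_on_compose2[OF continuous_ext_gh[OF continuous_on_val, THEN conjunct2]])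
        (auto simp: k intro!: continuous_intros)
    moreover have "int_ext f y = ext_h (val f) n (1 - y - real n)" if "y \<in> {of_int k .. of_int k + 1}" for y
      using int_ext_eqs(2)[of "1 - y - real n" f n] that by (auto simp: k)
    ultimately show ?thesis
      by (metis (no_types, lifting) continuous_on_eq)
  qed
  have "isCont (int_ext f) y" for y
  proof -
    define k where "k = \<lfloor>y\<rfloor>"
    have y: "of_int k \<le> y" "y < of_int k + 1"
      unfolding k_def by linarith+
    have "continuous_on ({of_int (k - 1) .. of_int (k - 1) + 1} \<union> {of_int k .. of_int k + 1}) (int_ext f)"
      by (intro continuous_on_closed_Un piece) auto
    moreover have "y \<in> {of_int k - 1 <..< of_int k + 1}"
      using y by auto
    moreover have "{of_int k - 1 <..< of_int k + 1 :: real}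
        \<subseteq> {of_int (k - 1) .. of_int (k - 1) + 1} \<union> {of_int k .. of_int k + 1}"
      by auto
    ultimately show ?thesis
      by (meson continuous_on_eq_continuous_at continuous_on_subset open_greaterThanLessThan)
  qed
  then show ?thesis
    by (simp add: continuous_at_imp_continuous_on)
qed

lemma val_C_mp:
  assumes "x \<in> {0..1}"
  shows "val (C_mp t f) x = (1/2) * (int_ext f (x + t) + int_ext f (x - t))"
  unfolding C_mp_def
  by (rule val_C01_of)
    (auto intro!: continuous_intros continuous_on_compose2[OF continuous_int_ext] assms
      simp: assms[simplified])

end

theory Submission
  imports Defs
begin

text \<open>
  The integral extension $F$ of $f$ is the only continuous function on the real line that agrees
  with $f$ on $[0,1]$ and satisfies two functional equations: $y \mapsto F(y) + F(1-y)$ is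
  1-periodic, and $O(y) = F(y) - F(1-y)$ satisfies $O(y+1) + O(y) = 2\int_y^{y+1} O$. Both are
  preserved by reflection about $1/2$ and by $F \mapsto \frac12(F(\cdot+t) + F(\cdot-t))$.
  Hence the extension of $C_{\rm mp}(t)f$ is the symmetrised translate of $F$, which
  gives the cosine equation and the invariance of both parity classes. The difference quotient
  of $C_{\rm mp}$ extends to the second symmetric difference of $F$, so $f$ is in the domain of
  the generator if and only if $F$ is $C^2$ on the whole line; differentiating the
  functional equations turns this into the boundary conditions at $0$ and $1$.
\<close>

section \<open>Evaluation on C[0,1], affine functions and antiderivatives on the line\<close>

lemma bounded_linear_val: "bounded_linear (\<lambda>f. val f x)"
proof (rule bounded_linear_intro[where K = 1])
  show "norm (val f x) \<le> norm f * 1" for f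
    using norm_bounded[of f "Unit x"] by (simp add: val_def)
qed (simp_all add: val_def)

lemmas val_add = linear_add[OF bounded_linear.linear[OF bounded_linear_val]]
  and val_minus = linear_neg[OF bounded_linear.linear[OF bounded_linear_val]]
  and val_diff = linear_diff[OF bounded_linear.linear[OF bounded_linear_val]]
  and val_scaleR = linear_scale[OF bounded_linear.linear[OF bounded_linear_val]]

lemma abs_val_le_norm: "\<bar>val f x\<bar> \<le> norm f"
  using norm_bounded[of f "Unit x"] by (simp add: val_def)

lemma C01_eqI:
  assumes "\<And>x. x \<in> {0..1} \<Longrightarrow> val f x = val g x"
  shows "f = g"
proof (rule bcontfun_eqI)
  fix u show "apply_bcontfun f u = apply_bcontfun g u"
    using assms[OF real_of_unit_range[of u]] by (simp add: val_def real_of_unit_inverse)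
qed

lemma norm_C01_le:
  assumes "\<And>x. x \<in> {0..1} \<Longrightarrow> \<bar>val f x\<bar> \<le> B"
  shows "norm f \<le> B"
proof (rule norm_bound)
  fix u show "norm (apply_bcontfun f u) \<le> B"
    using assms[OF real_of_unit_range[of u]] by (simp add: val_def real_of_unit_inverse)
qed

lemma affine_of_second_derivative_0:
  fixes e :: "real \<Rightarrow> real"
  assumes "\<And>y. (e has_real_derivative e1 y) (at y)"
    and "\<And>y. (e1 has_real_derivative 0) (at y)"
  shows "e y = e 0 + e1 0 * y"
proof -
  have e1: "e1 y = e1 0" for y
    using DERIV_isconst_all assms(2) by blast
  have "((\<lambda>y. e y - e1 0 * y) has_real_derivative 0) (at y)" for y
    by (rule derivative_eq_intros assms(1) refl)+ (simp add: e1[of y])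
  then have "e y - e1 0 * y = e 0 - e1 0 * 0"
    using DERIV_isconst_all by blast
  then show ?thesis by simp
qed

text \<open>The antiderivative must live on the whole line: \<open>integral {0..x} f\<close> would
  be 0 for negative x, so the two-sided version with infinite end points is used.\<close>

lemma continuous_antiderivative:
  fixes f :: "real \<Rightarrow> real"
  assumes "continuous_on UNIV f"
  obtains F where "\<And>y. (F has_real_derivative f y) (at y)"
proof -
  have "\<exists>F. \<forall>x::real. -\<infinity> < ereal x \<longrightarrow> ereal x < \<infinity> \<longrightarrow> (F has_vector_derivative f x) (at x)"
    by (rule einterval_antiderivative) (use assms in \<open>auto simp: continuous_on_eq_continuous_at\<close>)
  then show ?thesis
    using that by (auto simp: has_real_derivative_iff_has_vector_derivative)
qed

section \<open>A characterisation of the integral extension\<close>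

text \<open>
  The antiderivative \<open>W\<close> of the odd part serves to state the second functional equation without
  oriented integrals.
\<close>

definition mp_extension :: "(real \<Rightarrow> real) \<Rightarrow> bool"
  where "mp_extension F \<longleftrightarrow>
     continuous_on UNIV F
   \<and> (\<forall>y. F (y + 1) + F (- y) = F y + F (1 - y))
   \<and> (\<exists>W. (\<forall>y. (W has_real_derivative F y - F (1 - y)) (at y))
        \<and> (\<forall>y. F (y + 1) - F (- y) + (F y - F (1 - y)) = 2 * (W (y + 1) - W y)))"

lemma mp_extension_lincomb:
  assumes "mp_extension F" "mp_extension G"
  shows "mp_extension (\<lambda>y. a * F y + b * G y)"
proof -
  obtain V where V: "\<And>y. (V has_real_derivative F y - F (1 - y)) (at y)"
      "\<And>y. F (y + 1) - F (- y) + (F y - F (1 - y)) = 2 * (V (y + 1) - V y)"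
    and F: "continuous_on UNIV F" "\<And>y. F (y + 1) + F (- y) = F y + F (1 - y)"
    using assms(1) unfolding mp_extension_def by blast
  obtain W where W: "\<And>y. (W has_real_derivative G y - G (1 - y)) (at y)"
      "\<And>y. G (y + 1) - G (- y) + (G y - G (1 - y)) = 2 * (W (y + 1) - W y)"
    and G: "continuous_on UNIV G" "\<And>y. G (y + 1) + G (- y) = G y + G (1 - y)"
    using assms(2) unfolding mp_extension_def by blast
  show ?thesis
    unfolding mp_extension_def
  proof (intro conjI allI exI[of _ "\<lambda>y. a * V y + b * W y"])
    show "continuous_on UNIV (\<lambda>y. a * F y + b * G y)"
      by (intro continuous_intros F G)
    fix y
    have "a * (F (y + 1) + F (- y)) + b * (G (y + 1) + G (- y))
        = a * (F y + F (1 - y)) + b * (G y + G (1 - y))"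
      by (simp only: F G)
    then show "a * F (y + 1) + b * G (y + 1) + (a * F (- y) + b * G (- y))
        = a * F y + b * G y + (a * F (1 - y) + b * G (1 - y))"
      by (simp add: algebra_simps)
    show "((\<lambda>y. a * V y + b * W y) has_real_derivative
        a * F y + b * G y - (a * F (1 - y) + b * G (1 - y))) (at y)"
      by (rule derivative_eq_intros V W refl)+ (simp add: algebra_simps)
    have "a * (F (y + 1) - F (- y) + (F y - F (1 - y))) + b * (G (y + 1) - G (- y) + (G y - G (1 - y)))
        = a * (2 * (V (y + 1) - V y)) + b * (2 * (W (y + 1) - W y))"
      by (simp only: V W)
    then show "a * F (y + 1) + b * G (y + 1) - (a * F (- y) + b * G (- y))
        + (a * F y + b * G y - (a * F (1 - y) + b * G (1 - y)))
        = 2 * (a * V (y + 1) + b * W (y + 1) - (a * V y + b * W y))"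
      by (simp add: algebra_simps)
  qed
qed

lemma mp_extension_reflect:
  assumes "mp_extension F"
  shows "mp_extension (\<lambda>y. F (1 - y))"
proof -
  obtain V where V: "\<And>y. (V has_real_derivative F y - F (1 - y)) (at y)"
      "\<And>y. F (y + 1) - F (- y) + (F y - F (1 - y)) = 2 * (V (y + 1) - V y)"
    and F: "continuous_on UNIV F" "\<And>y. F (y + 1) + F (- y) = F y + F (1 - y)"
    using assms unfolding mp_extension_def by blast
  show ?thesis
    unfolding mp_extension_def
  \<comment> \<open>Reflection about 1/2 changes the sign of the odd part, hence of its
    antiderivative.\<close>
  proof (intro conjI allI exI[of _ "\<lambda>y. - V y"])
    show "continuous_on UNIV (\<lambda>y. F (1 - y))"
      by (rule continuous_on_compose2[OF F(1)]) (auto intro!: continuous_intros)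
    fix y
    show "F (1 - (y + 1)) + F (1 - - y) = F (1 - y) + F (1 - (1 - y))"
      using F(2)[of y] by (simp add: algebra_simps)
    show "((\<lambda>y. - V y) has_real_derivative F (1 - y) - F (1 - (1 - y))) (at y)"
      by (rule derivative_eq_intros V refl)+ simp
    show "F (1 - (y + 1)) - F (1 - - y) + (F (1 - y) - F (1 - (1 - y))) = 2 * (- V (y + 1) - - V y)"
      using V(2)[of y] by (simp add: algebra_simps)
  qed
qed

text \<open>Reflection about 1/2 exchanges the shifts by t and -t. The odd part of the symmetrised
  translate is therefore the symmetrised translate of the odd part, and both equations follow by
  averaging those for F at y + t and y - t.\<close>

lemma mp_extension_symmetric_shift:
  assumes "mp_extension F"
  shows "mp_extension (\<lambda>y. (1/2) * (F (y + t) + F (y - t)))"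
proof -
  obtain V where V: "\<And>y. (V has_real_derivative F y - F (1 - y)) (at y)"
      "\<And>y. F (y + 1) - F (- y) + (F y - F (1 - y)) = 2 * (V (y + 1) - V y)"
    and F: "continuous_on UNIV F" "\<And>y. F (y + 1) + F (- y) = F y + F (1 - y)"
    using assms unfolding mp_extension_def by blast
  show ?thesis
    unfolding mp_extension_def
  proof (intro conjI allI exI[of _ "\<lambda>y. (1/2) * (V (y + t) + V (y - t))"])
    show "continuous_on UNIV (\<lambda>y. (1/2) * (F (y + t) + F (y - t)))"
      by (intro continuous_intros continuous_on_compose2[OF F(1)]) auto
    fix y
    have eqs: "y + 1 + t = (y + t) + 1" "y + 1 - t = (y - t) + 1" "- y + t = - (y - t)"
        "- y - t = - (y + t)" "1 - y + t = 1 - (y - t)" "1 - y - t = 1 - (y + t)"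
      by simp_all
    show "1 / 2 * (F (y + 1 + t) + F (y + 1 - t)) + 1 / 2 * (F (- y + t) + F (- y - t))
        = 1 / 2 * (F (y + t) + F (y - t)) + 1 / 2 * (F (1 - y + t) + F (1 - y - t))"
      unfolding eqs using F(2)[of "y + t"] F(2)[of "y - t"] by argo
    have *: "((\<lambda>y. V (y + c)) has_real_derivative F (y + c) - F (1 - y - c)) (at y)" for c
      using DERIV_shift[of V "F (y + c) - F (1 - y - c)" y c] V(1)[of "y + c"]
      by (simp add: algebra_simps)
    have "((\<lambda>y. (1/2) * (V (y + t) + V (y + - t))) has_real_derivative
        1 / 2 * (F (y + t) + F (y - t)) - 1 / 2 * (F (1 - y + t) + F (1 - y - t))) (at y)"
      by (rule derivative_eq_intros * refl)+ (simp add: field_simps)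
    then show "((\<lambda>y. (1/2) * (V (y + t) + V (y - t))) has_real_derivative
        1 / 2 * (F (y + t) + F (y - t)) - 1 / 2 * (F (1 - y + t) + F (1 - y - t))) (at y)"
      by simp
    show "1 / 2 * (F (y + 1 + t) + F (y + 1 - t)) - 1 / 2 * (F (- y + t) + F (- y - t))
        + (1 / 2 * (F (y + t) + F (y - t)) - 1 / 2 * (F (1 - y + t) + F (1 - y - t)))
        = 2 * (1 / 2 * (V (y + 1 + t) + V (y + 1 - t)) - 1 / 2 * (V (y + t) + V (y - t)))"
      unfolding eqs using V(2)[of "y + t"] V(2)[of "y - t"] by argo
  qed
qed

section \<open>Uniqueness of the extension, by induction over unit cells\<close>

lemma unit_translate_cases:
  fixes y :: real
  obtains n x where "x \<in> {0..1}" "y = x + real n" | n x where "x \<in> {0..1}" "y = 1 - x - real n"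
proof (cases "0 \<le> y")
  case True
  show ?thesis
    by (rule that(1)[of "frac y" "nat \<lfloor>y\<rfloor>"]) (use True frac_lt_1[of y] in \<open>auto simp: frac_def\<close>)
next
  case False
  show ?thesis
    by (rule that(2)[of "frac (1 - y)" "nat \<lfloor>1 - y\<rfloor>"])
      (use False frac_lt_1[of "1 - y"] in \<open>auto simp: frac_def\<close>)
qed

lemma antisymmetric_antiderivative:
  fixes F :: "real \<Rightarrow> real"
  assumes "\<And>y. (W has_real_derivative F y - F (1 - y)) (at y)"
  shows "W (1 - y) = W y"
proof -
  have *: "((\<lambda>y. W (1 - y) - W y) has_real_derivative 0) (at y)" for y
    by (rule derivative_eq_intros DERIV_chain2[OF assms] refl assms)+ simp
  \<comment> \<open>The constant is read off at 1/2, the fixed point of the reflection, where it is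
    0.\<close>
  have "W (1 - y) - W y = W (1 - 1/2) - W (1/2)" for y
    using DERIV_isconst_all[of "\<lambda>y. W (1 - y) - W y"] * by blast
  then show ?thesis by simp
qed

text \<open>The vanishing spreads outwards by one cell on each side at a time. If D is 0 on the
  cells with index n, the second equation becomes the differential equation V' = 2 V for the
  increment V of \<open>W\<close> over a unit step, and V starts from 0.\<close>

lemma mp_extension_eq_0:
  assumes D: "mp_extension D" and D0: "\<And>x. x \<in> {0..1} \<Longrightarrow> D x = 0"
  shows "D y = 0"
proof -
  obtain W where W: "\<And>y. (W has_real_derivative D y - D (1 - y)) (at y)"
      "\<And>y. D (y + 1) - D (- y) + (D y - D (1 - y)) = 2 * (W (y + 1) - W y)"
    and e: "\<And>y. D (y + 1) + D (- y) = D y + D (1 - y)"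
    using D unfolding mp_extension_def by blast
  have "\<forall>x\<in>{0..1}. D (x + real n) = 0 \<and> D (1 - x - real n) = 0" for n
  proof (induction n)
    case 0
    then show ?case using D0 by auto
  next
    case (Suc n)
    define V where "V x = W (x + real n + 1) - W (x + real n)" for x
    have W': "((\<lambda>x. W (x + c)) has_real_derivative D (x + c) - D (1 - x - c)) (at x)" for x c
      using DERIV_shift[of W "D (x + c) - D (1 - x - c)" x c] W(1)[of "x + c"]
      by (simp add: algebra_simps)
    have V': "(V has_real_derivative 2 * V x) (at x within {0..1})" if "x \<in> {0..1}" for x
    proof -
      have "(V has_real_derivative D (x + real n + 1) - D (- x - real n)
          - (D (x + real n) - D (1 - x - real n))) (at x within {0..1})"
        unfolding V_def add.assoc
        by (rule derivative_eq_intros W'[THEN has_field_derivative_at_within] refl)+ simp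
      moreover have "D (x + real n + 1) - D (- x - real n) - (D (x + real n) - D (1 - x - real n)) = 2 * V x"
        using W(2)[of "x + real n"] Suc that by (simp add: V_def algebra_simps)
      ultimately show ?thesis by simp
    qed
    \<comment> \<open>Integrating factor for V' = 2 V.\<close>
    have "((\<lambda>x. exp (- 2 * x) * V x) has_real_derivative 0) (at x within {0..1})" if "x \<in> {0..1}" for x
      by (rule derivative_eq_intros V' that refl)+ simp
    then obtain c where c: "\<And>x. x \<in> {0..1} \<Longrightarrow> exp (- 2 * x) * V x = c"
      using has_field_derivative_zero_constant[of "{0..1::real}" "\<lambda>x. exp (- 2 * x) * V x"] by auto
    \<comment> \<open>On the current cell the odd part vanishes, so \<open>W\<close> has equal
      values at both ends of it; this is \<open>V 0 = 0\<close>.\<close>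
    have "((\<lambda>x. W (x + real n)) has_real_derivative 0) (at x within {0..1})" if "x \<in> {0..1}" for x
      using W'[of "real n" x, THEN has_field_derivative_at_within[where s = "{0..1}"]] Suc that by simp
    then obtain k where "\<And>x. x \<in> {0..1} \<Longrightarrow> W (x + real n) = k"
      using has_field_derivative_zero_constant[of "{0..1::real}" "\<lambda>x. W (x + real n)"] by auto
    from this[of 0] this[of 1] have "V 0 = 0"
      by (simp add: V_def add.commute)
    with c[of 0] have "c = 0" by simp
    show ?case
    proof
      fix x :: real assume x: "x \<in> {0..1}"
      have "V x = 0"
        using c[OF x] \<open>c = 0\<close> by simp
      \<comment> \<open>The second equation gives the difference of these two values, the first
        their sum; both are 0.\<close>
      then show "D (x + real (Suc n)) = 0 \<and> D (1 - x - real (Suc n)) = 0"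
        using W(2)[of "x + real n"] e[of "x + real n"] Suc[rule_format, OF x]
        by (simp add: V_def algebra_simps)
    qed
  qed
  then show ?thesis
    by (cases y rule: unit_translate_cases) auto
qed

lemma mp_extension_unique:
  assumes "mp_extension F" "mp_extension G" "\<And>x. x \<in> {0..1} \<Longrightarrow> F x = G x"
  shows "F = G"
proof
  fix y show "F y = G y"
    using mp_extension_eq_0[OF mp_extension_lincomb[OF assms(1,2), of 1 "-1"], of y] assms(3) by simp
qed

section \<open>Existence: the integral extension satisfies both functional equations\<close>

lemma int_ext_unit:
  assumes "x \<in> {0..1}"
  shows "int_ext f x = val f x"
  using int_ext_eqs(1)[OF assms, of f 0] by simp

text \<open>Adding the two recursion formulas cancels \<open>psi\<close> and leaves the first
  equation. Subtracting them reduces the second one to \<open>W (y + 1) - W y = psi d x\<close> for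
  y = x + n. Both sides have the same derivative in x and the same value at x = 0.\<close>

lemma mp_extension_int_ext: "mp_extension (int_ext f)"
proof -
  define F where "F = int_ext f"
  have contF: "continuous_on UNIV F"
    unfolding F_def by (rule continuous_int_ext)
  then have "continuous_on UNIV (\<lambda>y. F y - F (1 - y))"
    by (intro continuous_intros continuous_on_compose2[OF contF]) auto
  then obtain W where W: "\<And>y. (W has_real_derivative F y - F (1 - y)) (at y)"
    using continuous_antiderivative by blast
  have W': "((\<lambda>x. W (x + c)) has_real_derivative F (x + c) - F (1 - x - c)) (at x)" for x c
    using DERIV_shift[of W "F (x + c) - F (1 - x - c)" x c] W[of "x + c"]
    by (simp add: algebra_simps)
  have step: "F (y + 1) + F (- y) = F y + F (1 - y)
      \<and> F (y + 1) - F (- y) + (F y - F (1 - y)) = 2 * (W (y + 1) - W y)" if "0 \<le> y" for y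
  proof -
    define n where "n = nat \<lfloor>y\<rfloor>"
    define x where "x = frac y"
    have x: "x \<in> {0..1}" and y: "y = x + real n"
      using that frac_lt_1[of y] by (auto simp: n_def x_def frac_def)
    define d where "d = (\<lambda>x. ext_h (val f) n x - ext_g (val f) n x)"
    have F: "F (u + real n) = ext_g (val f) n u" "F (1 - u - real n) = ext_h (val f) n u"
      "F (u + real n + 1) = ext_h (val f) n u + psi d u"
      "F (- u - real n) = ext_g (val f) n u - psi d u" if "u \<in> {0..1}" for u
      using int_ext_eqs[OF that, of f n] int_ext_eqs[OF that, of f "Suc n"]
      by (simp_all add: F_def d_def add_ac algebra_simps)
    \<comment> \<open>The function integrated in the recursion is minus the odd part on the cell, so
      -\<open>W\<close> is an antiderivative of it.\<close>
    have d: "d u = - (F (u + real n) - F (1 - u - real n))" if "u \<in> {0..1}" for u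
      using F[OF that] by (simp add: d_def)
    have cd: "continuous_on {0..1} d"
      unfolding d_def using continuous_ext_gh[OF continuous_on_val] by (intro continuous_intros) auto
    have "((\<lambda>x. W (x + real n + 1) - W (x + real n) - psi d x) has_real_derivative 0) (at x within {0..1})"
      if "x \<in> {0..1}" for x
      unfolding add.assoc
      by (rule derivative_eq_intros W'[THEN has_field_derivative_at_within] psi_deriv[OF cd] that refl)+
        (use F[OF that] d[OF that] in \<open>simp add: algebra_simps\<close>)
    then obtain c where c: "\<And>x. x \<in> {0..1} \<Longrightarrow> W (x + real n + 1) - W (x + real n) - psi d x = c"
      using has_field_derivative_zero_constant[of "{0..1::real}"
          "\<lambda>x. W (x + real n + 1) - W (x + real n) - psi d x"] by auto
    \<comment> \<open>Integrating \<open>d\<close> over the cell identifies \<open>psi d 0\<close>,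
      which is minus that integral, with the increment of \<open>W\<close>; this makes the constant
      0.\<close>
    have "((\<lambda>x. - W (x + real n)) has_real_derivative d x) (at x within {0..1})" if "x \<in> {0..1}" for x
      by (rule derivative_eq_intros W'[THEN has_field_derivative_at_within] refl)+ (simp add: d[OF that])
    then have "(d has_integral (- W (1 + real n)) - (- W (0 + real n))) {0..1}"
      by (intro fundamental_theorem_of_calculus)
        (auto simp: has_real_derivative_iff_has_vector_derivative)
    then have "psi d 0 = W (real n + 1) - W (real n)"
      by (simp add: psi_0 integral_unique add.commute)
    with c[of 0] have "c = 0" by simp
    with c[OF x] F[OF x] show ?thesis
      by (simp add: y algebra_simps)
  qed
  \<comment> \<open>With this symmetry both equations turn into themselves under y to -y, which
    settles negative y.\<close>
  have sW: "W (1 - y) = W y" for y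
    by (rule antisymmetric_antiderivative[OF W])
  show ?thesis
    unfolding mp_extension_def F_def[symmetric]
  proof (intro conjI allI exI[of _ W] contF W)
    fix y
    show "F (y + 1) + F (- y) = F y + F (1 - y)"
      using step[of y] step[of "- y"] by (cases "0 \<le> y") (auto simp: algebra_simps)
    show "F (y + 1) - F (- y) + (F y - F (1 - y)) = 2 * (W (y + 1) - W y)"
      using step[of y] step[of "- y"] sW[of "y + 1"] sW[of y]
      by (cases "0 \<le> y") (auto simp: algebra_simps)
  qed
qed

text \<open>Through this rule an identity between extensions has to be checked on [0,1]
  only.\<close>

lemma int_ext_eqI:
  assumes "mp_extension F" "\<And>x. x \<in> {0..1} \<Longrightarrow> F x = val f x"
  shows "int_ext f = F"
  by (rule mp_extension_unique[OF mp_extension_int_ext assms(1)])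
    (use assms(2) int_ext_unit in auto)

section \<open>Linearity, translation and parity of the extension\<close>

lemma int_ext_lincomb: "int_ext (a *\<^sub>R f + b *\<^sub>R g) = (\<lambda>y. a * int_ext f y + b * int_ext g y)"
  by (intro int_ext_eqI mp_extension_lincomb mp_extension_int_ext)
    (auto simp: int_ext_unit val_add val_scaleR)

lemma int_ext_add: "int_ext (f + g) = (\<lambda>y. int_ext f y + int_ext g y)"
  and int_ext_diff: "int_ext (f - g) = (\<lambda>y. int_ext f y - int_ext g y)"
  and int_ext_scaleR: "int_ext (a *\<^sub>R f) = (\<lambda>y. a * int_ext f y)"
  using int_ext_lincomb[of 1 f 1 g] int_ext_lincomb[of 1 f "-1" g] int_ext_lincomb[of a f 0 f]
  by simp_all

lemma int_ext_C_mp: "int_ext (C_mp t f) = (\<lambda>y. (1/2) * (int_ext f (y + t) + int_ext f (y - t)))"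
  by (intro int_ext_eqI mp_extension_symmetric_shift mp_extension_int_ext) (simp add: val_C_mp)

lemma int_ext_even:
  assumes "f \<in> C_even"
  shows "int_ext f (1 - y) = int_ext f y"
proof -
  have "int_ext f = (\<lambda>y. int_ext f (1 - y))"
    by (intro int_ext_eqI mp_extension_reflect mp_extension_int_ext)
      (use assms in \<open>auto simp: C_even_def int_ext_unit\<close>)
  then show ?thesis by metis
qed

lemma int_ext_odd:
  assumes "f \<in> C_odd"
  shows "int_ext f (1 - y) = - int_ext f y"
proof -
  have "int_ext ((-1) *\<^sub>R f) = (\<lambda>y. int_ext f (1 - y))"
    by (intro int_ext_eqI mp_extension_reflect mp_extension_int_ext)
      (use assms in \<open>auto simp: C_odd_def int_ext_unit val_minus\<close>)
  then show ?thesis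
    unfolding int_ext_scaleR by (metis mult_minus1)
qed

section \<open>Cosine family\<close>

text \<open>Both exponentials are at most \<open>exp 2\<close> on [0,1]. The first term of
  \<open>psi\<close> contributes \<open>exp 2 * B\<close>, the second twice as much.\<close>

lemma abs_psi_le:
  assumes d: "continuous_on {0..1} d" and B: "\<And>y. y \<in> {0..1} \<Longrightarrow> \<bar>d y\<bar> \<le> B" and x: "x \<in> {0..1}"
  shows "\<bar>psi d x\<bar> \<le> 3 * exp 2 * B"
proof -
  have B0: "0 \<le> B"
    using B[of 0] by simp
  have "\<bar>integral {0..1} d\<bar> \<le> B"
    using integral_bound[of 0 1 d B] d B by simp
  then have 1: "exp (2 * x) * \<bar>integral {0..1} d\<bar> \<le> exp 2 * B"
    by (rule mult_mono[rotated]) (use x in auto)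
  have "\<bar>integral {0..x} (\<lambda>y. exp (2 * (x - y)) * d y)\<bar> \<le> exp 2 * B * (x - 0)"
    unfolding real_norm_def[symmetric]
  proof (rule integral_bound)
    show "continuous_on {0..x} (\<lambda>y. exp (2 * (x - y)) * d y)"
      by (intro continuous_intros continuous_on_subset[OF d]) (use x in auto)
    show "norm (exp (2 * (x - y)) * d y) \<le> exp 2 * B" if "y \<in> {0..x}" for y
      unfolding norm_mult by (rule mult_mono) (use B[of y] x that in auto)
  qed (use x in auto)
  also have "\<dots> \<le> exp 2 * B * 1"
    by (rule mult_left_mono) (use x B0 in auto)
  finally have 2: "\<bar>integral {0..x} (\<lambda>y. exp (2 * (x - y)) * d y)\<bar> \<le> exp 2 * B"
    by simp
  have "\<bar>psi d x\<bar> \<le> \<bar>exp (2 * x) * integral {0..1} d\<bar> + \<bar>2 * integral {0..x} (\<lambda>y. exp (2 * (x - y)) * d y)\<bar>"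
    unfolding psi_def by linarith
  then show ?thesis
    using 1 2 by (simp add: abs_mult)
qed

text \<open>If both functions are bounded by B, their difference is bounded by 2 B and its
  \<open>psi\<close> by \<open>6 * exp 2 * B\<close>; each step of the recursion thus costs a factor
  \<open>1 + 6 * exp 2\<close>.\<close>

lemma abs_ext_gh_le:
  "\<forall>x\<in>{0..1}. \<bar>ext_g (val f) n x\<bar> \<le> (1 + 6 * exp 2) ^ n * norm f
     \<and> \<bar>ext_h (val f) n x\<bar> \<le> (1 + 6 * exp 2) ^ n * norm f"
proof (induction n)
  case 0
  then show ?case by (simp add: abs_val_le_norm)
next
  case (Suc n)
  define B where "B = (1 + 6 * exp (2::real)) ^ n * norm f"
  define d where "d = (\<lambda>y. ext_h (val f) n y - ext_g (val f) n y)"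
  have IH: "\<bar>ext_g (val f) n x\<bar> \<le> B" "\<bar>ext_h (val f) n x\<bar> \<le> B" if "x \<in> {0..1}" for x
    using Suc that by (auto simp: B_def)
  have "continuous_on {0..1} d"
    unfolding d_def using continuous_ext_gh[OF continuous_on_val] by (intro continuous_intros) auto
  then have psi: "\<bar>psi d x\<bar> \<le> 3 * exp 2 * (2 * B)" if "x \<in> {0..1}" for x
    by (rule abs_psi_le) (use IH that in \<open>fastforce simp: d_def\<close>)+
  show ?case
  proof
    fix x :: real assume x: "x \<in> {0..1}"
    have "(1 + 6 * exp 2) ^ Suc n * norm f = B + 3 * exp 2 * (2 * B)"
      by (simp add: B_def algebra_simps)
    then show "\<bar>ext_g (val f) (Suc n) x\<bar> \<le> (1 + 6 * exp 2) ^ Suc n * norm f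
        \<and> \<bar>ext_h (val f) (Suc n) x\<bar> \<le> (1 + 6 * exp 2) ^ Suc n * norm f"
      using IH[OF x] psi[OF x] by (simp only: ext_g.simps ext_h.simps d_def) linarith
  qed
qed

lemma abs_int_ext_le:
  obtains K where "\<And>f y. \<bar>y\<bar> \<le> r \<Longrightarrow> \<bar>int_ext f y\<bar> \<le> K * norm f"
proof
  let ?K = "(1 + 6 * exp 2) ^ nat \<lceil>1 + r\<rceil> :: real"
  fix f :: C01 and y :: real assume y: "\<bar>y\<bar> \<le> r"
  \<comment> \<open>A point of modulus at most r lies in a cell of index at most 1 + r; the extra 1
    comes from the form 1 - x - n on the left.\<close>
  have K: "(1 + 6 * exp 2) ^ n * norm f \<le> ?K * norm f" if "real n \<le> 1 + r" for n
    by (intro mult_right_mono power_increasing) (use that in linarith, simp_all)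
  show "\<bar>int_ext f y\<bar> \<le> ?K * norm f"
  proof (cases y rule: unit_translate_cases)
    case (1 n x)
    then show ?thesis
      using abs_ext_gh_le[of f n] K[of n] y by (fastforce simp: int_ext_eqs(1)[OF 1(1)])
  next
    case (2 n x)
    then show ?thesis
      using abs_ext_gh_le[of f n] K[of n] y by (fastforce simp: int_ext_eqs(2)[OF 2(1)])
  qed
qed

lemma C_mp_lincomb: "C_mp t (a *\<^sub>R f + b *\<^sub>R g) = a *\<^sub>R C_mp t f + b *\<^sub>R C_mp t g"
  by (rule C01_eqI) (simp add: val_C_mp int_ext_lincomb val_add val_scaleR algebra_simps)

lemma C_mp_add: "C_mp t (f + g) = C_mp t f + C_mp t g"
  and C_mp_scaleR: "C_mp t (a *\<^sub>R f) = a *\<^sub>R C_mp t f"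
  using C_mp_lincomb[of t 1 f 1 g] C_mp_lincomb[of t a f 0 g] by simp_all

lemma abs_half_sum_le:
  fixes a b :: real
  shows "\<bar>a\<bar> \<le> B \<Longrightarrow> \<bar>b\<bar> \<le> B \<Longrightarrow> \<bar>(1/2) * (a + b)\<bar> \<le> B"
  by (auto simp: abs_le_iff)

lemma C_mp_bounded: "\<exists>K. \<forall>f. norm (C_mp t f) \<le> K * norm f"
proof -
  obtain K where K: "\<And>f y. \<bar>y\<bar> \<le> 1 + \<bar>t\<bar> \<Longrightarrow> \<bar>int_ext f y\<bar> \<le> K * norm f"
    using abs_int_ext_le by blast
  have "norm (C_mp t f) \<le> K * norm f" for f
  proof (rule norm_C01_le)
    fix x :: real assume x: "x \<in> {0..1}"
    then have "\<bar>int_ext f (x + t)\<bar> \<le> K * norm f" "\<bar>int_ext f (x - t)\<bar> \<le> K * norm f"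
      by (auto intro!: K)
    then show "\<bar>val (C_mp t f) x\<bar> \<le> K * norm f"
      unfolding val_C_mp[OF x] by (rule abs_half_sum_le)
  qed
  then show ?thesis by blast
qed

lemma C_mp_0: "C_mp 0 f = f"
  by (rule C01_eqI) (simp add: val_C_mp int_ext_unit)

lemma C_mp_cosine: "2 *\<^sub>R C_mp t (C_mp s f) = C_mp (t + s) f + C_mp (t - s) f"
  by (rule C01_eqI)
    (simp add: val_C_mp int_ext_C_mp val_add val_scaleR algebra_simps)

lemma uniform_continuity_Icc:
  fixes F :: "real \<Rightarrow> real"
  assumes "continuous_on UNIV F" "0 < e"
  obtains d where "0 < d" "\<And>x z. x \<in> {a..b} \<Longrightarrow> \<bar>z - x\<bar> < d \<Longrightarrow> \<bar>F z - F x\<bar> < e"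
proof -
  \<comment> \<open>The point z may leave [a, b]; the margin 1, with \<open>min d 1\<close> below,
    keeps it in a compact interval.\<close>
  have "uniformly_continuous_on {a - 1..b + 1} F"
    by (rule compact_uniformly_continuous) (use assms continuous_on_subset in auto)
  then obtain d where d: "0 < d" "\<And>x z. x \<in> {a - 1..b + 1} \<Longrightarrow> z \<in> {a - 1..b + 1} \<Longrightarrow>
      \<bar>z - x\<bar> < d \<Longrightarrow> \<bar>F z - F x\<bar> < e"
    using assms(2) unfolding uniformly_continuous_on_def dist_real_def by blast
  show ?thesis
    by (rule that[of "min d 1"]) (use d(1) in simp, rule d(2), auto)
qed

lemma C_mp_tendsto: "((\<lambda>t. C_mp t f) \<longlongrightarrow> f) (at 0)"
proof (rule LIM_I)
  fix e :: real assume "0 < e"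
  then obtain d where d: "0 < d"
      "\<And>x z. x \<in> {0..1} \<Longrightarrow> \<bar>z - x\<bar> < d \<Longrightarrow> \<bar>int_ext f z - int_ext f x\<bar> < e / 2"
    using uniform_continuity_Icc[OF continuous_int_ext, of "e / 2" 0 1] by (metis half_gt_zero)
  have "norm (C_mp t f - f) < e" if "\<bar>t\<bar> < d" for t
  proof -
    have "norm (C_mp t f - f) \<le> e / 2"
    proof (rule norm_C01_le)
      fix x :: real assume x: "x \<in> {0..1}"
      have "\<bar>int_ext f (x + t) - int_ext f x\<bar> < e / 2" "\<bar>int_ext f (x - t) - int_ext f x\<bar> < e / 2"
        by (rule d(2)[OF x]; use that in simp)+
      then show "\<bar>val (C_mp t f - f) x\<bar> \<le> e / 2"
        unfolding val_diff val_C_mp[OF x] int_ext_unit[OF x, of f, symmetric] abs_le_iff abs_less_iff by argo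
    qed
    with \<open>0 < e\<close> show ?thesis by simp
  qed
  with d(1) show "\<exists>s>0. \<forall>t. t \<noteq> 0 \<and> norm (t - 0) < s \<longrightarrow> norm (C_mp t f - f) < e"
    by auto
qed

lemma cosine_family_on_restriction:
  assumes "subspace X" "closed X" "\<And>t. C_mp t ` X \<subseteq> X"
  shows "cosine_family_on X (\<lambda>t. restrict (C_mp t) X)"
  unfolding cosine_family_on_def bounded_operator_on_def
proof (intro conjI allI ballI assms)
  \<comment> \<open>Invariance keeps inner applications in X, where \<open>restrict\<close> returns
    the operator's value; elsewhere it is \<open>undefined\<close>.\<close>
  have X: "C_mp t f \<in> X" if "f \<in> X" for t f
    using assms(3) that by blast
  show "restrict (C_mp t) X ` X \<subseteq> X" for t
    using X by auto
  show "\<exists>K. \<forall>x\<in>X. norm (restrict (C_mp t) X x) \<le> K * norm x" for t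
    using C_mp_bounded[of t] by auto
  show "((\<lambda>t. restrict (C_mp t) X x) \<longlongrightarrow> x) (at 0)" if "x \<in> X" for x
    using C_mp_tendsto[of x] that by simp
  show "2 *\<^sub>R restrict (C_mp t) X (restrict (C_mp s) X x)
      = restrict (C_mp (t + s)) X x + restrict (C_mp (t - s)) X x" if "x \<in> X" for s t x
    using that X by (simp add: C_mp_cosine)
qed (use assms(1) in \<open>auto simp: C_mp_0 C_mp_add C_mp_scaleR subspace_add subspace_scale\<close>)

section \<open>Second differences\<close>

text \<open>Lagrange form of the remainder. Since t may be negative, it serves both x + t and x -
  t.\<close>

lemma Taylor_second_order:
  fixes F :: "real \<Rightarrow> real"
  assumes "\<And>y. (F has_real_derivative F1 y) (at y)" "\<And>y. (F1 has_real_derivative G y) (at y)" "t \<noteq> 0"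
  obtains z where "\<bar>z - x\<bar> < \<bar>t\<bar>" "F (x + t) = F x + F1 x * t + G z / 2 * t\<^sup>2"
proof -
  define D where "D n = (if n = 0 then F else if n = 1 then F1 else G)" for n :: nat
  have "\<forall>m y. m < 2 \<and> x - \<bar>t\<bar> \<le> y \<and> y \<le> x + \<bar>t\<bar> \<longrightarrow> (D m has_real_derivative D (Suc m) y) (at y)"
    using assms(1,2) by (auto simp: D_def less_2_cases_iff)
  then have "\<exists>z. (if x + t < x then x + t < z \<and> z < x else x < z \<and> z < x + t) \<and>
      F (x + t) = (\<Sum>m<2. D m x / fact m * (x + t - x) ^ m) + D 2 z / fact 2 * (x + t - x)\<^sup>2"
    by (intro Taylor[of 2 D F "x - \<bar>t\<bar>" "x + \<bar>t\<bar>"]) (use assms(3) in \<open>auto simp: D_def\<close>)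
  then obtain z where "if x + t < x then x + t < z \<and> z < x else x < z \<and> z < x + t"
      "F (x + t) = (\<Sum>m<2. D m x / fact m * (x + t - x) ^ m) + D 2 z / fact 2 * (x + t - x)\<^sup>2"
    by blast
  then show ?thesis
    by (intro that[of z]) (auto simp: D_def numeral_2_eq_2 split: if_splits)
qed

text \<open>In the expansions at x + t and x - t the linear terms cancel. The quotient is the mean
  of two values of G at points closer to x than t, so uniform continuity of G suffices.\<close>

lemma second_difference_uniform:
  fixes F :: "real \<Rightarrow> real"
  assumes F: "\<And>y. (F has_real_derivative F1 y) (at y)" "\<And>y. (F1 has_real_derivative G y) (at y)"
    and G: "continuous_on UNIV G" and e: "0 < e"
  obtains d where "0 < d" "\<And>x t. x \<in> {a..b} \<Longrightarrow> t \<noteq> 0 \<Longrightarrow> \<bar>t\<bar> < d \<Longrightarrow>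
    \<bar>(F (x + t) + F (x - t) - 2 * F x) / t\<^sup>2 - G x\<bar> < e"
proof -
  obtain d where d: "0 < d" "\<And>x z. x \<in> {a..b} \<Longrightarrow> \<bar>z - x\<bar> < d \<Longrightarrow> \<bar>G z - G x\<bar> < e"
    using uniform_continuity_Icc[OF G e] by blast
  have "\<bar>(F (x + t) + F (x - t) - 2 * F x) / t\<^sup>2 - G x\<bar> < e"
    if x: "x \<in> {a..b}" and t: "t \<noteq> 0" "\<bar>t\<bar> < d" for x t
  proof -
    obtain u where u: "\<bar>u - x\<bar> < \<bar>t\<bar>" "F (x + t) = F x + F1 x * t + G u / 2 * t\<^sup>2"
      using Taylor_second_order[OF F t(1)] by blast
    obtain v where v: "\<bar>v - x\<bar> < \<bar>t\<bar>" "F (x - t) = F x - F1 x * t + G v / 2 * t\<^sup>2"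
      using Taylor_second_order[OF F, of "- t" x] t(1) by auto
    have "F (x + t) + F (x - t) - 2 * F x = (G u + G v) / 2 * t\<^sup>2"
      unfolding u(2) v(2) by (simp add: field_simps)
    then have "(F (x + t) + F (x - t) - 2 * F x) / t\<^sup>2 = (G u + G v) / 2"
      using t(1) by simp
    moreover have "\<bar>G u - G x\<bar> < e" "\<bar>G v - G x\<bar> < e"
      using d(2)[OF x] u(1) v(1) t(2) by auto
    ultimately show ?thesis
      unfolding abs_less_iff by argo
  qed
  with d(1) that show ?thesis by blast
qed

lemma second_difference_tendsto:
  fixes F :: "real \<Rightarrow> real"
  assumes "\<And>y. (F has_real_derivative F1 y) (at y)" "\<And>y. (F1 has_real_derivative G y) (at y)"
    and "continuous_on UNIV G"
  shows "((\<lambda>t. (F (x + t) + F (x - t) - 2 * F x) / t\<^sup>2) \<longlongrightarrow> G x) (at 0)"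
proof (rule LIM_I)
  fix e :: real assume "0 < e"
  with assms obtain d where "0 < d" "\<And>y t. y \<in> {x..x} \<Longrightarrow> t \<noteq> 0 \<Longrightarrow> \<bar>t\<bar> < d \<Longrightarrow>
      \<bar>(F (y + t) + F (y - t) - 2 * F y) / t\<^sup>2 - G y\<bar> < e"
    using second_difference_uniform by blast
  then show "\<exists>s>0. \<forall>t. t \<noteq> 0 \<and> norm (t - 0) < s \<longrightarrow>
      norm ((F (x + t) + F (x - t) - 2 * F x) / t\<^sup>2 - G x) < e"
    by auto
qed

text \<open>A maximum principle. Subtracting a multiple of the parabola (x - a)(b - x) adds 2 e > 0
  to the limit of the second difference quotients, whereas these quotients are nonpositive near an
  interior maximum.\<close>

lemma second_difference_0_le_0:
  fixes u :: "real \<Rightarrow> real"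
  assumes u: "continuous_on {a..b} u"
    and lim: "\<And>x. ((\<lambda>t. (u (x + t) + u (x - t) - 2 * u x) / t\<^sup>2) \<longlongrightarrow> 0) (at 0)"
    and ab: "u a \<le> 0" "u b \<le> 0" and c: "c \<in> {a..b}"
  shows "u c \<le> 0"
proof (rule ccontr)
  assume "\<not> u c \<le> 0"
  then have uc: "0 < u c" by simp
  with ab c have c': "a < c" "c < b"
    by (auto simp: less_le)
  define p where "p = (c - a) * (b - c)"
  have p: "0 < p"
    using c' by (simp add: p_def)
  \<comment> \<open>This choice halves the value at c. The perturbed function is still positive
    there and nonpositive at a and b, so its maximum is interior.\<close>
  define e where "e = u c / (2 * p)"
  have e: "0 < e"
    using uc p by (simp add: e_def)
  define v where "v x = u x - e * ((x - a) * (b - x))" for x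
  have "v c = u c / 2"
    using p by (simp add: v_def e_def flip: p_def)
  then have vc: "0 < v c" using uc by simp
  have "continuous_on {a..b} v"
    unfolding v_def by (intro continuous_intros u)
  then obtain m where m: "m \<in> {a..b}" "\<And>x. x \<in> {a..b} \<Longrightarrow> v x \<le> v m"
    using continuous_attains_sup[of "{a..b}" v] c by auto
  have "m \<noteq> a" "m \<noteq> b"
    using m(2)[OF c] vc ab by (auto simp: v_def)
  with m(1) have m': "a < m" "m < b" by auto
  have "((\<lambda>t. (u (m + t) + u (m - t) - 2 * u m) / t\<^sup>2 + 2 * e) \<longlongrightarrow> 0 + 2 * e) (at 0)"
    by (intro tendsto_intros lim)
  then have "0 + 2 * e \<le> 0"
  proof (rule tendsto_upperbound)
    have "\<forall>\<^sub>F t in at 0. t \<noteq> 0 \<and> \<bar>t\<bar> < min (m - a) (b - m)"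
      unfolding eventually_at by (rule exI[of _ "min (m - a) (b - m)"]) (use m' in auto)
    then show "\<forall>\<^sub>F t in at 0. (u (m + t) + u (m - t) - 2 * u m) / t\<^sup>2 + 2 * e \<le> 0"
    proof (rule eventually_mono)
      fix t assume t: "t \<noteq> 0 \<and> \<bar>t\<bar> < min (m - a) (b - m)"
      then have "v (m + t) \<le> v m" "v (m - t) \<le> v m"
        by (auto intro!: m(2))
      moreover have "v (m + t) + v (m - t) - 2 * v m = u (m + t) + u (m - t) - 2 * u m + 2 * e * t\<^sup>2"
        by (simp add: v_def algebra_simps power2_eq_square)
      ultimately have "(u (m + t) + u (m - t) - 2 * u m + 2 * e * t\<^sup>2) / t\<^sup>2 \<le> 0"
        by (intro divide_nonpos_nonneg) auto
      then show "(u (m + t) + u (m - t) - 2 * u m) / t\<^sup>2 + 2 * e \<le> 0"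
        using t by (simp add: add_divide_distrib)
    qed
  qed simp
  with e show False by simp
qed

text \<open>The maximum principle, applied to u minus its chord and to the chord minus u, shows that
  u coincides with its chord on every compact interval.\<close>

lemma affine_of_second_difference_0:
  fixes u :: "real \<Rightarrow> real"
  assumes u: "continuous_on UNIV u"
    and lim: "\<And>x. ((\<lambda>t. (u (x + t) + u (x - t) - 2 * u x) / t\<^sup>2) \<longlongrightarrow> 0) (at 0)"
  shows "u y = u 0 + (u 1 - u 0) * y"
proof -
  have interpolate: "(b - a) * u c = (b - c) * u a + (c - a) * u b" if "a \<le> c" "c \<le> b" for a b c
  proof (cases "a = b")
    case False
    with that have ab: "a < b" by simp
    define s where "s = (u b - u a) / (b - a)"
    define L where "L x = u a + s * (x - a)" for x
    have L: "L (x + t) + L (x - t) - 2 * L x = 0" "L a = u a" for x t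
      by (simp_all add: L_def algebra_simps)
    have "L b = u b"
      using ab by (simp add: L_def s_def)
    note L = L this
    have contL: "continuous_on {a..b} L"
      unfolding L_def by (intro continuous_intros)
    have uab: "continuous_on {a..b} u"
      using u continuous_on_subset by blast
    have eq1: "u (x + t) - L (x + t) + (u (x - t) - L (x - t)) - 2 * (u x - L x)
        = u (x + t) + u (x - t) - 2 * u x"
      and eq2: "L (x + t) - u (x + t) + (L (x - t) - u (x - t)) - 2 * (L x - u x)
        = - (u (x + t) + u (x - t) - 2 * u x)" for x t
      using L(1)[of x t] by argo+
    have lim1: "((\<lambda>t. (u (x + t) - L (x + t) + (u (x - t) - L (x - t)) - 2 * (u x - L x)) / t\<^sup>2) \<longlongrightarrow> 0) (at 0)" for x
      unfolding eq1 by (rule lim)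
    have lim2: "((\<lambda>t. (L (x + t) - u (x + t) + (L (x - t) - u (x - t)) - 2 * (L x - u x)) / t\<^sup>2) \<longlongrightarrow> 0) (at 0)" for x
      using tendsto_minus[OF lim[of x]] unfolding eq2 minus_divide_left by simp
    have 1: "u c - L c \<le> 0"
      by (rule second_difference_0_le_0[of a b "\<lambda>x. u x - L x", OF continuous_on_diff[OF uab contL] lim1])
        (use that L in auto)
    have 2: "L c - u c \<le> 0"
      by (rule second_difference_0_le_0[of a b "\<lambda>x. L x - u x", OF continuous_on_diff[OF contL uab] lim2])
        (use that L in auto)
    from 1 2 have "u c = L c" by simp
    then show ?thesis
      using ab by (simp add: L_def s_def field_simps)
  qed (use that in auto)
  \<comment> \<open>Interpolation among the points 0, 1 and y, with whichever lies in the middle as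
    c.\<close>
  consider "y \<le> 0" | "0 \<le> y" "y \<le> 1" | "1 \<le> y" by linarith
  then show ?thesis
    by cases (use interpolate[of y 0 1] interpolate[of 0 y 1] interpolate[of 0 1 y] in \<open>auto simp: algebra_simps\<close>)
qed

text \<open>A theorem of Schwarz, reduced to the affine case by subtracting a second antiderivative of $G$.\<close>

lemma second_derivative_of_second_difference:
  fixes F :: "real \<Rightarrow> real"
  assumes F: "continuous_on UNIV F" and G: "continuous_on UNIV G"
    and lim: "\<And>x. ((\<lambda>t. (F (x + t) + F (x - t) - 2 * F x) / t\<^sup>2) \<longlongrightarrow> G x) (at 0)"
  obtains F1 where "\<And>y. (F has_real_derivative F1 y) (at y)" "\<And>y. (F1 has_real_derivative G y) (at y)"
proof -
  obtain H1 where H1: "\<And>y. (H1 has_real_derivative G y) (at y)"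
    using continuous_antiderivative[OF G] by blast
  then have "continuous_on UNIV H1"
    by (meson DERIV_isCont continuous_at_imp_continuous_on)
  then obtain H where H: "\<And>y. (H has_real_derivative H1 y) (at y)"
    using continuous_antiderivative by blast
  define u where "u x = F x - H x" for x
  have "continuous_on UNIV H"
    using H by (meson DERIV_isCont continuous_at_imp_continuous_on)
  then have "continuous_on UNIV u"
    unfolding u_def by (intro continuous_intros F)
  moreover have "((\<lambda>t. (u (x + t) + u (x - t) - 2 * u x) / t\<^sup>2) \<longlongrightarrow> 0) (at 0)" for x
    using tendsto_diff[OF lim[of x] second_difference_tendsto[OF H H1 G, of x]]
    by (simp add: u_def algebra_simps flip: diff_divide_distrib)
  ultimately have u: "u y = u 0 + (u 1 - u 0) * y" for y
    by (rule affine_of_second_difference_0)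
  have F_eq: "F = (\<lambda>y. H y + (u 0 + (u 1 - u 0) * y))"
    using u by (auto simp: u_def fun_eq_iff algebra_simps)
  show ?thesis
  proof
    show "(F has_real_derivative H1 y + (u 1 - u 0)) (at y)" for y
      by (subst F_eq) (rule derivative_eq_intros H refl | simp)+
    show "((\<lambda>y. H1 y + (u 1 - u 0)) has_real_derivative G y) (at y)" for y
      by (rule derivative_eq_intros H1 refl | simp)+
  qed
qed

section \<open>Generator\<close>

text \<open>This transports norm convergence in C[0,1] to convergence of the extensions at every
  real point.\<close>

lemma bounded_linear_int_ext: "bounded_linear (\<lambda>f. int_ext f y)"
proof -
  obtain K where "\<And>f z. \<bar>z\<bar> \<le> \<bar>y\<bar> \<Longrightarrow> \<bar>int_ext f z\<bar> \<le> K * norm f"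
    using abs_int_ext_le by blast
  then show ?thesis
    by (intro bounded_linear_intro[where K = K])
      (auto simp: int_ext_add int_ext_scaleR mult.commute)
qed

lemma int_ext_difference_quotient:
  "int_ext ((2 / t\<^sup>2) *\<^sub>R (C_mp t f - f)) y = (int_ext f (y + t) + int_ext f (y - t) - 2 * int_ext f y) / t\<^sup>2"
  \<comment> \<open>For t = 0 both sides are 0 because division by zero yields 0.\<close>
  unfolding int_ext_scaleR int_ext_diff int_ext_C_mp by (cases "t = 0") (simp_all add: field_simps)

text \<open>Forwards, the second difference quotients of the extension converge at every real point,
  and Schwarz's theorem applies. Backwards, the Taylor estimate is uniform on [0,1], which is
  convergence in the supremum norm.\<close>

lemma difference_quotient_tendsto_iff:
  "((\<lambda>t. (2 / t\<^sup>2) *\<^sub>R (C_mp t f - f)) \<longlongrightarrow> g) (at 0) \<longleftrightarrow>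
   (\<exists>F1. (\<forall>y. (int_ext f has_real_derivative F1 y) (at y))
       \<and> (\<forall>y. (F1 has_real_derivative int_ext g y) (at y)))"
proof
  assume lim: "((\<lambda>t. (2 / t\<^sup>2) *\<^sub>R (C_mp t f - f)) \<longlongrightarrow> g) (at 0)"
  have "((\<lambda>t. (int_ext f (y + t) + int_ext f (y - t) - 2 * int_ext f y) / t\<^sup>2) \<longlongrightarrow> int_ext g y) (at 0)" for y
    using bounded_linear.tendsto[OF bounded_linear_int_ext lim, of y]
    by (simp only: int_ext_difference_quotient)
  then show "\<exists>F1. (\<forall>y. (int_ext f has_real_derivative F1 y) (at y))
      \<and> (\<forall>y. (F1 has_real_derivative int_ext g y) (at y))"
    by (rule second_derivative_of_second_difference[OF continuous_int_ext continuous_int_ext]) blast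
next
  assume "\<exists>F1. (\<forall>y. (int_ext f has_real_derivative F1 y) (at y))
      \<and> (\<forall>y. (F1 has_real_derivative int_ext g y) (at y))"
  then obtain F1 where F1: "\<And>y. (int_ext f has_real_derivative F1 y) (at y)"
      "\<And>y. (F1 has_real_derivative int_ext g y) (at y)"
    by blast
  show "((\<lambda>t. (2 / t\<^sup>2) *\<^sub>R (C_mp t f - f)) \<longlongrightarrow> g) (at 0)"
  proof (rule LIM_I)
    fix e :: real assume "0 < e"
    then have "0 < e / 2" by simp
    from second_difference_uniform[OF F1 continuous_int_ext this, of 0 1]
    obtain d where d: "0 < d" "\<And>x t. x \<in> {0..1} \<Longrightarrow> t \<noteq> 0 \<Longrightarrow> \<bar>t\<bar> < d \<Longrightarrow>
        \<bar>(int_ext f (x + t) + int_ext f (x - t) - 2 * int_ext f x) / t\<^sup>2 - int_ext g x\<bar> < e / 2"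
      by blast
    have "norm ((2 / t\<^sup>2) *\<^sub>R (C_mp t f - f) - g) < e" if t: "t \<noteq> 0" "\<bar>t\<bar> < d" for t
    proof -
      have "norm ((2 / t\<^sup>2) *\<^sub>R (C_mp t f - f) - g) \<le> e / 2"
      proof (rule norm_C01_le)
        fix x :: real assume x: "x \<in> {0..1}"
        show "\<bar>val ((2 / t\<^sup>2) *\<^sub>R (C_mp t f - f) - g) x\<bar> \<le> e / 2"
          using d(2)[OF x t]
          unfolding int_ext_unit[OF x, symmetric] int_ext_diff[of "(2 / t\<^sup>2) *\<^sub>R (C_mp t f - f)" g]
            int_ext_difference_quotient
          by simp
      qed
      with \<open>0 < e\<close> show ?thesis by simp
    qed
    with d(1) show "\<exists>s>0. \<forall>t. t \<noteq> 0 \<and> norm (t - 0) < s \<longrightarrow>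
        norm ((2 / t\<^sup>2) *\<^sub>R (C_mp t f - f) - g) < e"
      by auto
  qed
qed

text \<open>Differentiating the functional equations at 0: the first forces equal slopes at 0 and 1,
  the second then determines their common value.\<close>

lemma mp_extension_boundary:
  assumes F: "mp_extension F" and F1: "\<And>y. (F has_real_derivative F1 y) (at y)"
  shows "F1 0 = F 1 - F 0" "F1 1 = F 1 - F 0"
proof -
  obtain W where W: "\<And>y. (W has_real_derivative F y - F (1 - y)) (at y)"
      \<comment> \<open>Written as defects equal to 0, the equations rewrite the differentiated
        function to a constant.\<close>
      "\<And>y. F (y + 1) - F (- y) + (F y - F (1 - y)) - 2 * (W (y + 1) - W y) = 0"
    and e: "\<And>y. F (y + 1) + F (- y) - (F y + F (1 - y)) = 0"
    using F unfolding mp_extension_def by force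
  have "((\<lambda>y. F (y + 1) + F (- y) - (F y + F (1 - y))) has_real_derivative
      F1 1 - F1 0 - (F1 0 - F1 1)) (at 0)"
    by (rule derivative_eq_intros DERIV_chain2[OF F1] refl)+ simp
  then have *: "F1 1 = F1 0"
    unfolding e using DERIV_unique[OF _ DERIV_const] by fastforce
  have "((\<lambda>y. F (y + 1) - F (- y) + (F y - F (1 - y)) - 2 * (W (y + 1) - W y)) has_real_derivative
      F1 1 + F1 0 + (F1 0 + F1 1) - 2 * (F 1 - F 0 - (F 0 - F 1))) (at 0)"
    by (rule derivative_eq_intros DERIV_chain2[OF F1] DERIV_chain2[OF W(1)] refl)+ simp
  then have "F1 1 + F1 0 + (F1 0 + F1 1) - 2 * (F 1 - F 0 - (F 0 - F 1)) = 0"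
    unfolding W(2) using DERIV_unique[OF _ DERIV_const] by blast
  with * show "F1 0 = F 1 - F 0" "F1 1 = F 1 - F 0"
    by auto
qed

text \<open>
  The boundary conditions are exactly the initial conditions that make the defects of the two
  functional equations, whose second derivatives vanish, vanish themselves.
\<close>

lemma mp_extension_of_second_derivative:
  assumes G: "mp_extension G"
    and F1: "\<And>y. (F has_real_derivative F1 y) (at y)" and F2: "\<And>y. (F1 has_real_derivative G y) (at y)"
    and bc: "F1 0 = F 1 - F 0" "F1 1 = F 1 - F 0"
  shows "mp_extension F"
proof -
  obtain V where V: "\<And>y. (V has_real_derivative G y - G (1 - y)) (at y)"
      "\<And>y. G (y + 1) - G (- y) + (G y - G (1 - y)) = 2 * (V (y + 1) - V y)"
    and G: "\<And>y. G (y + 1) + G (- y) = G y + G (1 - y)"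
    using G unfolding mp_extension_def by blast
  have contF: "continuous_on UNIV F"
    using F1 by (meson DERIV_isCont continuous_at_imp_continuous_on)
  then have "continuous_on UNIV (\<lambda>y. F y - F (1 - y))"
    by (intro continuous_intros continuous_on_compose2[OF contF]) auto
  then obtain W where W: "\<And>y. (W has_real_derivative F y - F (1 - y)) (at y)"
    using continuous_antiderivative by blast
  \<comment> \<open>The even part of \<open>F1\<close> is another antiderivative of the odd part of
    G, so it has the same increments as \<open>V\<close>.\<close>
  have "((\<lambda>y. V y - (F1 y + F1 (1 - y))) has_real_derivative 0) (at y)" for y
    by (rule derivative_eq_intros DERIV_chain2[OF F2] V refl)+ simp
  then have V_const: "V y - (F1 y + F1 (1 - y)) = V z - (F1 z + F1 (1 - z))" for y z
    using DERIV_isconst_all[of "\<lambda>y. V y - (F1 y + F1 (1 - y))"] by blast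
  have VF1: "V (y + 1) - V y = F1 (y + 1) + F1 (- y) - (F1 y + F1 (1 - y))" for y
    using V_const[of "y + 1" y] by (simp add: algebra_simps)
  have e: "F (y + 1) + F (- y) - (F y + F (1 - y)) = 0" for y
  proof -
    define e where "e y = F (y + 1) + F (- y) - (F y + F (1 - y))" for y
    define e1 where "e1 y = F1 (y + 1) - F1 (- y) - (F1 y - F1 (1 - y))" for y
    have "(e has_real_derivative e1 y) (at y)" for y
      unfolding e_def e1_def
      by (rule derivative_eq_intros DERIV_chain2[OF F1] refl)+ simp
    moreover have "(e1 has_real_derivative 0) (at y)" for y
      unfolding e1_def
      by (rule derivative_eq_intros DERIV_chain2[OF F2] refl)+ (use G[of y] in simp)
    ultimately have "e y = e 0 + e1 0 * y"
      by (rule affine_of_second_derivative_0)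
    then show ?thesis
      by (simp add: e_def e1_def bc)
  qed
  have q: "F (y + 1) - F (- y) + (F y - F (1 - y)) - 2 * (W (y + 1) - W y) = 0" for y
  proof -
    define q where "q y = F (y + 1) - F (- y) + (F y - F (1 - y)) - 2 * (W (y + 1) - W y)" for y
    define q1 where "q1 y = F1 (y + 1) + F1 (- y) + (F1 y + F1 (1 - y))
        - 2 * (F (y + 1) - F (- y) - (F y - F (1 - y)))" for y
    have "(q has_real_derivative q1 y) (at y)" for y
      unfolding q_def q1_def
      by (rule derivative_eq_intros DERIV_chain2[OF F1] DERIV_chain2[OF W] refl)+ simp
    moreover have "(q1 has_real_derivative 0) (at y)" for y
      unfolding q1_def
      by (rule derivative_eq_intros DERIV_chain2[OF F1] DERIV_chain2[OF F2] refl)+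
        (use V(2)[of y] VF1[of y] in simp)
    ultimately have "q y = q 0 + q1 0 * y"
      by (rule affine_of_second_derivative_0)
    \<comment> \<open>The value \<open>q 0\<close> is 0 because \<open>W\<close> agrees at 0 and 1;
      \<open>q1 0\<close> is 0 by the boundary conditions.\<close>
    then show ?thesis
      using antisymmetric_antiderivative[OF W, of 0] by (simp add: q_def q1_def bc)
  qed
  show ?thesis
    unfolding mp_extension_def
  proof (intro conjI allI exI[of _ W] contF W)
    show "F (y + 1) + F (- y) = F y + F (1 - y)" for y
      using e[of y] by simp
    show "F (y + 1) - F (- y) + (F y - F (1 - y)) = 2 * (W (y + 1) - W y)" for y
      using q[of y] by simp
  qed
qed

section \<open>One-sided derivatives on [0,1] and the domain of the generator\<close>

lemma deriv01_eqI:
  assumes "(\<phi> has_real_derivative D) (at x within {0..1})" "x \<in> {0..1}"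
  shows "deriv01 \<phi> x = D"
  unfolding deriv01_def
  by (rule vector_derivative_within_closed_interval)
    (use assms in \<open>auto simp: has_real_derivative_iff_has_vector_derivative\<close>)

lemma deriv01_works:
  assumes "\<phi> differentiable_on {0..1}" "x \<in> {0..1}"
  shows "(\<phi> has_real_derivative deriv01 \<phi> x) (at x within {0..1})"
  using assms unfolding deriv01_def differentiable_on_def
  by (simp add: has_real_derivative_iff_has_vector_derivative flip: vector_derivative_works)

lemma eq_on_unit_of_derivative:
  fixes F :: "real \<Rightarrow> real"
  assumes "\<And>x. x \<in> {0..1} \<Longrightarrow> (F has_real_derivative D x) (at x within {0..1})"
    and "\<And>x. x \<in> {0..1} \<Longrightarrow> (G has_real_derivative D x) (at x within {0..1})"
    and "F 0 = G 0" "x \<in> {0..1}"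
  shows "F x = G x"
proof -
  have "((\<lambda>x. F x - G x) has_real_derivative 0) (at x within {0..1})" if "x \<in> {0..1}" for x
    using DERIV_diff[OF assms(1,2)[OF that]] by simp
  then obtain c where "\<And>x. x \<in> {0..1} \<Longrightarrow> F x - G x = c"
    using has_field_derivative_zero_constant[of "{0..1::real}" "\<lambda>x. F x - G x"] by auto
  from this[of 0] this[of x] show ?thesis
    using assms(3,4) by simp
qed

lemma antiderivative_with_initial_value:
  fixes f :: "real \<Rightarrow> real"
  assumes "continuous_on UNIV f"
  obtains F where "\<And>y. (F has_real_derivative f y) (at y)" "F 0 = c"
proof -
  obtain F where F: "\<And>y. (F has_real_derivative f y) (at y)"
    using continuous_antiderivative[OF assms] by blast
  show ?thesis
  proof
    show "((\<lambda>y. F y + (c - F 0)) has_real_derivative f y) (at y)" for y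
      by (rule derivative_eq_intros F refl | simp)+
  qed simp
qed

text \<open>Forwards, restrict to [0,1] and read off the boundary conditions. Backwards, integrate
  \<open>int_ext g\<close> twice over the line with the initial data of f: the result agrees with f
  on [0,1] and satisfies both equations, so by uniqueness it is \<open>int_ext f\<close>.\<close>

lemma second_derivative_int_ext_iff:
  "(\<exists>F1. (\<forall>y. (int_ext f has_real_derivative F1 y) (at y))
       \<and> (\<forall>y. (F1 has_real_derivative int_ext g y) (at y))) \<longleftrightarrow>
   f \<in> C2_01 \<and> deriv01 (val f) 0 = val f 1 - val f 0 \<and> deriv01 (val f) 1 = val f 1 - val f 0
     \<and> g = second_deriv f"
  (is "?L \<longleftrightarrow> ?R")
proof
  assume ?L
  then obtain F1 where F1: "\<And>y. (int_ext f has_real_derivative F1 y) (at y)"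
      "\<And>y. (F1 has_real_derivative int_ext g y) (at y)"
    by blast
  have D1: "(val f has_real_derivative F1 x) (at x within {0..1})" if "x \<in> {0..1}" for x
    by (rule has_field_derivative_transform_within[OF F1(1)[THEN has_field_derivative_at_within], where d = 1])
      (use that int_ext_unit in auto)
  then have d1: "deriv01 (val f) x = F1 x" if "x \<in> {0..1}" for x
    using deriv01_eqI that by blast
  have D2: "(deriv01 (val f) has_real_derivative val g x) (at x within {0..1})" if "x \<in> {0..1}" for x
    unfolding int_ext_unit[OF that, symmetric]
    by (rule has_field_derivative_transform_within[OF F1(2)[THEN has_field_derivative_at_within], where d = 1])
      (use that d1 in auto)
  then have d2: "deriv01 (deriv01 (val f)) x = val g x" if "x \<in> {0..1}" for x
    using deriv01_eqI that by blast
  have cont: "continuous_on {0..1} (deriv01 (deriv01 (val f)))"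
    by (rule continuous_on_eq[OF continuous_on_val[of g]]) (simp add: d2)
  have "f \<in> C2_01"
    unfolding C2_01_def differentiable_on_def differentiable_def mem_Collect_eq
    using cont D1[THEN has_field_derivative_imp_has_derivative] D2[THEN has_field_derivative_imp_has_derivative]
    by blast
  moreover have "g = second_deriv f"
    unfolding second_deriv_def by (rule C01_eqI) (simp add: val_C01_of[OF cont] d2)
  moreover have "F1 0 = val f 1 - val f 0" "F1 1 = val f 1 - val f 0"
    using mp_extension_boundary[OF mp_extension_int_ext F1(1)] by (simp_all add: int_ext_unit)
  ultimately show ?R
    by (simp add: d1)
next
  assume R: ?R
  then have f: "val f differentiable_on {0..1}" "deriv01 (val f) differentiable_on {0..1}"
      "continuous_on {0..1} (deriv01 (deriv01 (val f)))"
    by (auto simp: C2_01_def)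
  obtain F1 where F1: "\<And>y. (F1 has_real_derivative int_ext g y) (at y)" "F1 0 = deriv01 (val f) 0"
    using antiderivative_with_initial_value[OF continuous_int_ext] by blast
  then have "continuous_on UNIV F1"
    by (meson DERIV_isCont continuous_at_imp_continuous_on)
  then obtain F where F: "\<And>y. (F has_real_derivative F1 y) (at y)" "F 0 = val f 0"
    using antiderivative_with_initial_value by blast
  have g: "int_ext g x = deriv01 (deriv01 (val f)) x" if "x \<in> {0..1}" for x
    using R that f(3) by (simp add: int_ext_unit second_deriv_def val_C01_of)
  have F1_eq: "F1 x = deriv01 (val f) x" if "x \<in> {0..1}" for x
  proof (rule eq_on_unit_of_derivative[of F1 "deriv01 (deriv01 (val f))" "deriv01 (val f)", OF _ _ F1(2) that])
    show "(deriv01 (val f) has_real_derivative deriv01 (deriv01 (val f)) x) (at x within {0..1})"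
      if "x \<in> {0..1}" for x
      by (rule deriv01_works[OF f(2) that])
    show "(F1 has_real_derivative deriv01 (deriv01 (val f)) x) (at x within {0..1})" if "x \<in> {0..1}" for x
      using F1(1)[of x] by (simp add: g[OF that] has_field_derivative_at_within)
  qed
  have F_eq: "F x = val f x" if "x \<in> {0..1}" for x
  proof (rule eq_on_unit_of_derivative[of F "deriv01 (val f)" "val f", OF _ _ F(2) that])
    show "(val f has_real_derivative deriv01 (val f) x) (at x within {0..1})" if "x \<in> {0..1}" for x
      by (rule deriv01_works[OF f(1) that])
    show "(F has_real_derivative deriv01 (val f) x) (at x within {0..1})" if "x \<in> {0..1}" for x
      using F(1)[of x] by (simp add: F1_eq[OF that] has_field_derivative_at_within)
  qed
  have "int_ext f = F"
  proof (rule int_ext_eqI[OF _ F_eq])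
    show "mp_extension F"
      by (rule mp_extension_of_second_derivative[OF mp_extension_int_ext F(1) F1(1)])
        (use R in \<open>auto simp: F1_eq F_eq\<close>)
  qed
  with F(1) F1(1) show ?L by blast
qed

text \<open>Difference quotients of elements of X stay in X, and so does their limit because X is
  closed. Restriction therefore imposes no condition beyond membership in X.\<close>

lemma generator_restriction:
  assumes X: "subspace X" "closed X" and inv: "\<And>t. C_mp t ` X \<subseteq> X"
  shows "generator_domain X (\<lambda>t. restrict (C_mp t) X) = {f \<in> X \<inter> C2_01.
      deriv01 (val f) 0 = val f 1 - val f 0 \<and> deriv01 (val f) 1 = val f 1 - val f 0}" (is ?dom)
    and "f \<in> generator_domain X (\<lambda>t. restrict (C_mp t) X) \<Longrightarrow>
      generator (\<lambda>t. restrict (C_mp t) X) f = second_deriv f"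
proof -
  have lim_iff: "((\<lambda>t. (2 / t\<^sup>2) *\<^sub>R (restrict (C_mp t) X f - f)) \<longlongrightarrow> g) (at 0) \<longleftrightarrow>
      f \<in> C2_01 \<and> deriv01 (val f) 0 = val f 1 - val f 0 \<and> deriv01 (val f) 1 = val f 1 - val f 0
        \<and> g = second_deriv f" if "f \<in> X" for f g
    using that difference_quotient_tendsto_iff[of f g] second_derivative_int_ext_iff[of f g] by simp
  have "g \<in> X" if f: "f \<in> X" and lim: "((\<lambda>t. (2 / t\<^sup>2) *\<^sub>R (restrict (C_mp t) X f - f)) \<longlongrightarrow> g) (at 0)" for f g
  proof (rule Lim_in_closed_set[OF X(2) _ _ lim])
    have "(2 / t\<^sup>2) *\<^sub>R (restrict (C_mp t) X f - f) \<in> X" for t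
      using f inv[of t] by (auto intro!: subspace_scale subspace_diff X(1))
    then show "\<forall>\<^sub>F t in at 0. (2 / t\<^sup>2) *\<^sub>R (restrict (C_mp t) X f - f) \<in> X"
      by simp
  qed simp
  then show dom: ?dom
    unfolding generator_domain_def using lim_iff by blast
  show "generator (\<lambda>t. restrict (C_mp t) X) f = second_deriv f"
    if "f \<in> generator_domain X (\<lambda>t. restrict (C_mp t) X)"
    unfolding generator_def
    by (rule tendsto_Lim) (use that lim_iff[of f "second_deriv f"] dom in auto)
qed

section \<open>Even and odd functions\<close>

text \<open>Even and odd functions are the cases c = 1 and c = -1.\<close>

lemma subspace_closed_parity:
  "subspace {f. \<forall>x\<in>{0..1}. val f (1 - x) = c * val f x}"
  "closed {f. \<forall>x\<in>{0..1}. val f (1 - x) = c * val f x}"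
proof -
  show "subspace {f. \<forall>x\<in>{0..1}. val f (1 - x) = c * val f x}"
    by (rule subspaceI) (auto simp: val_add val_scaleR algebra_simps val_def)
  have "continuous_on UNIV (\<lambda>f. val f x)" for x
    by (rule linear_continuous_on[OF bounded_linear_val])
  then have "closed (\<Inter>x\<in>{0..1}. {f. val f (1 - x) = c * val f x})"
    by (intro closed_INT ballI closed_Collect_eq continuous_intros)
  moreover have "(\<Inter>x\<in>{0..1}. {f. val f (1 - x) = c * val f x}) = {f. \<forall>x\<in>{0..1}. val f (1 - x) = c * val f x}"
    by blast
  ultimately show "closed {f. \<forall>x\<in>{0..1}. val f (1 - x) = c * val f x}"
    by simp
qed

lemma subspace_C_even: "subspace C_even" and closed_C_even: "closed C_even"
  and subspace_C_odd: "subspace C_odd" and closed_C_odd: "closed C_odd"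
  using subspace_closed_parity[of 1] subspace_closed_parity[of "-1"]
  by (simp_all add: C_even_def C_odd_def)

lemma C_mp_C_even: "C_mp t ` C_even \<subseteq> C_even"
proof clarify
  fix f assume f: "f \<in> C_even"
  have "int_ext f (1 - x + t) = int_ext f (x - t)" "int_ext f (1 - x - t) = int_ext f (x + t)" for x
    using int_ext_even[OF f, of "x - t"] int_ext_even[OF f, of "x + t"] by (simp_all add: algebra_simps)
  then show "C_mp t f \<in> C_even"
    by (simp add: C_even_def val_C_mp)
qed

lemma C_mp_C_odd: "C_mp t ` C_odd \<subseteq> C_odd"
proof clarify
  fix f assume f: "f \<in> C_odd"
  have "int_ext f (1 - x + t) = - int_ext f (x - t)" "int_ext f (1 - x - t) = - int_ext f (x + t)" for x
    using int_ext_odd[OF f, of "x - t"] int_ext_odd[OF f, of "x + t"] by (simp_all add: algebra_simps)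
  then have "val (C_mp t f) (1 - x) = - val (C_mp t f) x" if "x \<in> {0..1}" for x
    using that by (simp add: val_C_mp) argo
  then show "C_mp t f \<in> C_odd"
    by (simp add: C_odd_def)
qed

text \<open>For even f the first functional equation says that the extension is 1-periodic. All its
  values are then values of f, and averaging two of them cannot exceed
  \<open>norm f\<close>.\<close>

lemma C_mp_contraction_on_C_even:
  assumes f: "f \<in> C_even"
  shows "norm (C_mp t f) \<le> norm f"
proof -
  note even = int_ext_even[OF f]
  have step: "int_ext f (y + 1) = int_ext f y" for y
  proof -
    have "int_ext f (y + 1) + int_ext f (- y) = int_ext f y + int_ext f (1 - y)"
      using mp_extension_int_ext unfolding mp_extension_def by blast
    then show ?thesis
      using even[of y] even[of "y + 1"] by simp
  qed
  have periodic: "int_ext f (y + real n) = int_ext f y" for y n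
  proof (induction n)
    case (Suc n)
    then show ?case
      using step[of "y + real n"] by (simp add: add_ac)
  qed simp
  have "\<bar>int_ext f y\<bar> \<le> norm f" for y
  proof (cases y rule: unit_translate_cases)
    case (1 n x)
    then show ?thesis
      by (simp add: periodic int_ext_unit abs_val_le_norm)
  next
    case (2 n x)
    then show ?thesis
      using even[of "x + real n"] by (simp add: periodic int_ext_unit abs_val_le_norm diff_diff_eq)
  qed
  then show ?thesis
    by (intro norm_C01_le) (simp only: val_C_mp abs_half_sum_le)
qed

text \<open>Chain rule at 0 for the reflection, which maps [0,1] onto itself and exchanges its end
  points; this makes the two boundary conditions equivalent within a parity class.\<close>

lemma deriv01_parity:
  assumes f: "val f differentiable_on {0..1}" and par: "\<And>x. x \<in> {0..1} \<Longrightarrow> val f (1 - x) = c * val f x"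
  shows "deriv01 (val f) 1 = - c * deriv01 (val f) 0"
proof -
  have "(\<lambda>x::real. 1 - x) ` {0..1} = {0..1}"
    by (auto simp: image_iff intro: bexI[of _ "1 - _"])
  then have "(val f has_real_derivative deriv01 (val f) 1) (at (1 - 0) within (\<lambda>x. 1 - x) ` {0..1})"
    using deriv01_works[OF f, of 1] by simp
  moreover have "((\<lambda>x::real. 1 - x) has_real_derivative - 1) (at 0 within {0..1})"
    by (rule derivative_eq_intros refl)+ simp
  ultimately have "(val f \<circ> (\<lambda>x. 1 - x) has_real_derivative deriv01 (val f) 1 * - 1) (at 0 within {0..1})"
    by (rule DERIV_image_chain)
  then have "((\<lambda>x. c * val f x) has_real_derivative deriv01 (val f) 1 * - 1) (at 0 within {0..1})"
    by (rule has_field_derivative_transform_within[where d = 1]) (use par in auto)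
  then have "deriv01 (\<lambda>x. c * val f x) 0 = deriv01 (val f) 1 * - 1"
    by (rule deriv01_eqI) simp
  moreover have "deriv01 (\<lambda>x. c * val f x) 0 = c * deriv01 (val f) 0"
    by (intro deriv01_eqI DERIV_cmult deriv01_works[OF f]) auto
  ultimately show ?thesis by simp
qed

lemma C_A0_eq: "C_A0 = (\<lambda>t. restrict (C_mp t) C_even)"
  and C_A1_eq: "C_A1 = (\<lambda>t. restrict (C_mp t) C_odd)"
  by (simp_all add: fun_eq_iff C_A0_def C_A1_def)

text \<open>Here f(1) = f(0) and f'(1) = -f'(0), so both boundary conditions reduce to f'(0) =
  0.\<close>

lemma generator_domain_C_A0:
  "generator_domain C_even C_A0 = {f \<in> C_even \<inter> C2_01. deriv01 (val f) 0 = 0}"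
proof -
  have "deriv01 (val f) 1 = - deriv01 (val f) 0 \<and> val f 1 = val f 0" if "f \<in> C_even \<inter> C2_01" for f
  proof -
    have "val f differentiable_on {0..1}" and par: "val f (1 - x) = 1 * val f x" if "x \<in> {0..1}" for x
      using \<open>f \<in> C_even \<inter> C2_01\<close> that by (auto simp: C_even_def C2_01_def)
    then show ?thesis
      using deriv01_parity[of f 1] par[of 0] by fastforce
  qed
  then show ?thesis
    unfolding C_A0_eq generator_restriction(1)[OF subspace_C_even closed_C_even C_mp_C_even]
    by (intro Collect_cong) fastforce
qed

text \<open>Here f(1) = -f(0) and f'(1) = f'(0), so both boundary conditions reduce to f'(0) = -2
  f(0).\<close>

lemma generator_domain_C_A1:
  "generator_domain C_odd C_A1 = {f \<in> C_odd \<inter> C2_01. deriv01 (val f) 0 = - 2 * val f 0}"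
proof -
  have "deriv01 (val f) 1 = deriv01 (val f) 0 \<and> val f 1 = - val f 0" if "f \<in> C_odd \<inter> C2_01" for f
  proof -
    have "val f differentiable_on {0..1}" and par: "val f (1 - x) = - 1 * val f x" if "x \<in> {0..1}" for x
      using \<open>f \<in> C_odd \<inter> C2_01\<close> that by (auto simp: C_odd_def C2_01_def)
    then show ?thesis
      using deriv01_parity[of f "-1"] par[of 0] by fastforce
  qed
  then show ?thesis
    unfolding C_A1_eq generator_restriction(1)[OF subspace_C_odd closed_C_odd C_mp_C_odd]
    by (intro Collect_cong) fastforce
qed

lemma continuous_on_val_reflect: "continuous_on {0..1} (\<lambda>x. val f (1 - x))"
  by (rule continuous_on_compose2[OF continuous_on_val]) (auto intro!: continuous_intros)

lemma val_even_part:
  assumes "x \<in> {0..1}"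
  shows "val (even_part f) x = (1/2) * (val f x + val f (1 - x))"
  unfolding even_part_def
  by (rule val_C01_of[OF _ assms]) (intro continuous_intros continuous_on_val continuous_on_val_reflect)

lemma val_odd_part:
  assumes "x \<in> {0..1}"
  shows "val (odd_part f) x = (1/2) * (val f x - val f (1 - x))"
  unfolding odd_part_def
  by (rule val_C01_of[OF _ assms]) (intro continuous_intros continuous_on_val continuous_on_val_reflect)

lemma C_mp_decomposition: "C_mp t f = C_A0 t (even_part f) + C_A1 t (odd_part f)"
proof -
  have "even_part f \<in> C_even" "odd_part f \<in> C_odd"
    by (simp_all add: C_even_def C_odd_def val_even_part val_odd_part field_simps)
  moreover have "even_part f + odd_part f = f"
    by (rule C01_eqI) (simp add: val_add val_even_part val_odd_part field_simps)
  ultimately show ?thesis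
    by (simp add: C_A0_def C_A1_def flip: C_mp_add)
qed

theorem proposition3p2:
  shows
   "((\<forall>t. C_mp t ` C_even \<subseteq> C_even)
     \<and> cosine_family_on C_even C_A0
     \<and> contractions_on C_even C_A0
     \<and> generator_domain C_even C_A0 = {f \<in> C_even \<inter> C2_01. deriv01 (val f) 0 = 0}
     \<and> (\<forall>f \<in> generator_domain C_even C_A0. generator C_A0 f = second_deriv f))
  \<and> ((\<forall>t. C_mp t ` C_odd \<subseteq> C_odd)
     \<and> cosine_family_on C_odd C_A1
     \<and> generator_domain C_odd C_A1 = {f \<in> C_odd \<inter> C2_01. deriv01 (val f) 0 = - 2 * val f 0}
     \<and> (\<forall>f \<in> generator_domain C_odd C_A1. generator C_A1 f = second_deriv f))
  \<and> (\<forall>f t. C_mp t f = C_A0 t (even_part f) + C_A1 t (odd_part f))"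
proof (intro conjI allI ballI)
  show "cosine_family_on C_even C_A0"
    unfolding C_A0_eq
    by (rule cosine_family_on_restriction[OF subspace_C_even closed_C_even C_mp_C_even])
  show "cosine_family_on C_odd C_A1"
    unfolding C_A1_eq
    by (rule cosine_family_on_restriction[OF subspace_C_odd closed_C_odd C_mp_C_odd])
  show "contractions_on C_even C_A0"
    by (simp add: contractions_on_def C_A0_def C_mp_contraction_on_C_even)
  show "generator C_A0 f = second_deriv f" if "f \<in> generator_domain C_even C_A0" for f
    using that unfolding C_A0_eq
    by (rule generator_restriction(2)[OF subspace_C_even closed_C_even C_mp_C_even])
  show "generator C_A1 f = second_deriv f" if "f \<in> generator_domain C_odd C_A1" for f
    using that unfolding C_A1_eq
    by (rule generator_restriction(2)[OF subspace_C_odd closed_C_odd C_mp_C_odd])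
qed (rule C_mp_C_even C_mp_C_odd generator_domain_C_A0 generator_domain_C_A1 C_mp_decomposition)+

end
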